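(* Let $g_1,\dots,g_m\in\mathbb{R}[\mathbf{x}]$ and suppose that the set $\Omega=\{\mathbf{x}\in\mathbb{R}^n: g_j(\mathbf{x})\ge0,\ j=1,\dots,m\}$ is compact with nonempty interior. Let $d_j=\lceil(\deg g_j)/2\rceil$ for $j=1,\dots,m$. Let $\lambda$ be a finite Borel measure on $\Omega$ with $\operatorname{supp}\lambda=\Omega$ and let $u\in L^2(\Omega,\lambda)$ be nonnegative. For $d\ge\max_j d_j$ consider the optimization problem $$\begin{array}{cl}\displaystyle\min_{u_d\in\mathbb{R}[\mathbf{x}]_d} & \|u-u_d\|_2^2\\ \text{s.t.} & u_d(\mathbf{x})=\mathbf{b}_d(\mathbf{x})^T\mathbf{A}_0\,\mathbf{b}_d(\mathbf{x})+\sum_{j=1}^m \mathbf{b}_{d-d_j}(\mathbf{x})^T\mathbf{A}_j\,\mathbf{b}_{d-d_j}(\mathbf{x})\,g_j(\mathbf{x})\quad\text{(as polynomials)},\\ & \mathbf{A}_0\in\mathbb{S}^{s(d)}_+,\quad \mathbf{A}_j\in\mathbb{S}^{s(d-d_j)}_+,\quad j=1,\dots,m.\end{array}$$ Then for every $d\ge\max_j d_j$ this problem has an optimal solution $u^*_d$, and $\|u-u^*_d\|_2^2\to0$ as $d\to\infty$.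
   Context: $\mathbb{R}[\mathbf{x}]$ is the ring of real polynomials in $\mathbf{x}=(x_1,\dots,x_n)$ and $\mathbb{R}[\mathbf{x}]_d$ the subspace of polynomials of degree at most $d$. $s(d)=\binom{n+d}{d}$. $\mathbf{b}_d(\mathbf{x})=(1,x_1,\dots,x_n,x_1^2,x_1x_2,\dots,x_n^d)^T$ is the vector of all $s(d)$ monomials of degree at most $d$. $\mathbb{S}^k_+$ is the cone of real symmetric positive semidefinite $k\times k$ matrices. $\|\cdot\|_2$ is the norm of $L^2(\Omega,\lambda)$. The minimization is over $u_d$ together with the matrices $\mathbf{A}_0,\dots,\mathbf{A}_m$. The support of a measure is taken in the usual topological sense. *)

theory Defs
  imports "HOL-Analysis.Analysis" "HOL-Library.Poly_Mapping" "Jordan_Normal_Form.Matrix"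
begin

hide_type (open) Matrix.vec

text \<open>
  Polynomials in \<open>n = CARD('n)\<close> variables: finitely supported maps from exponent vectors to
  coefficients, with the ring structure (convolution product) of \<open>Poly_Mapping\<close>.
  The statement takes the index type \<open>'n\<close> to be finite and linearly ordered, the order being the
  one in which the variables \<open>x\<^sub>1, \<dots>, x\<^sub>n\<close> are listed.
\<close>

type_synonym 'n monomial = "'n \<Rightarrow>\<^sub>0 nat"
type_synonym 'n rpoly = "'n monomial \<Rightarrow>\<^sub>0 real"

definition mono_deg :: "'n::finite monomial \<Rightarrow> nat" where
  "mono_deg \<alpha> = (\<Sum>i\<in>UNIV. Poly_Mapping.lookup \<alpha> i)"

text \<open>The zero polynomial gets degree \<open>0\<close>.\<close>

definition poly_deg :: "'n::finite rpoly \<Rightarrow> nat" where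
  "poly_deg p = Max (insert 0 (mono_deg ` Poly_Mapping.keys p))"

definition poly_eval :: "'n::finite rpoly \<Rightarrow> real ^ 'n \<Rightarrow> real" where
  "poly_eval p x = (\<Sum>\<alpha>\<in>Poly_Mapping.keys p.
     Poly_Mapping.lookup p \<alpha> * (\<Prod>i\<in>UNIV. vec_nth x i ^ Poly_Mapping.lookup \<alpha> i))"

definition const_poly :: "real \<Rightarrow> 'n rpoly" where
  "const_poly c = Poly_Mapping.single 0 c"

definition mono_poly :: "'n monomial \<Rightarrow> 'n rpoly" where
  "mono_poly \<alpha> = Poly_Mapping.single \<alpha> 1"

text \<open>
  The monomials of degree at most \<open>d\<close>, listed as
  \<open>1, x\<^sub>1, \<dots>, x\<^sub>n, x\<^sub>1\<^sup>2, x\<^sub>1 x\<^sub>2, \<dots>, x\<^sub>n\<^sup>d\<close>.  The order on exponent vectors is lexicographic with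
  \<open>x\<^sub>n < \<dots> < x\<^sub>1\<close>, hence the reversal within each degree.
\<close>

definition monomials_upto :: "nat \<Rightarrow> 'n::{finite,linorder} monomial list" where
  "monomials_upto d =
     concat (map (\<lambda>k. rev (sorted_list_of_set {\<alpha>. mono_deg \<alpha> = k})) [0..<d+1])"

definition basis_vec :: "nat \<Rightarrow> 'n::{finite,linorder} rpoly Matrix.vec" where
  "basis_vec d = vec_of_list (map mono_poly (monomials_upto d))"

definition num_monomials :: "'n::finite itself \<Rightarrow> nat \<Rightarrow> nat" where
  "num_monomials _ d = (CARD('n) + d) choose d"

definition psd_mats :: "nat \<Rightarrow> real mat set" where
  "psd_mats k = {A \<in> carrier_mat k k. transpose_mat A = A \<and>
                   (\<forall>v\<in>carrier_vec k. 0 \<le> scalar_prod v (A *\<^sub>v v))}"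

text \<open>The polynomial \<open>b\<^sub>d\<^sup>T A b\<^sub>d\<close>.\<close>

definition gram_poly :: "nat \<Rightarrow> real mat \<Rightarrow> 'n::{finite,linorder} rpoly" where
  "gram_poly d A = scalar_prod (basis_vec d) (map_mat const_poly A *\<^sub>v basis_vec d)"

definition half_deg :: "'n::finite rpoly \<Rightarrow> nat" where
  "half_deg p = nat \<lceil>real (poly_deg p) / 2\<rceil>"

definition semialg_set :: "nat \<Rightarrow> (nat \<Rightarrow> 'n::finite rpoly) \<Rightarrow> (real ^ 'n) set" where
  "semialg_set m g = {x. \<forall>j\<in>{1..m}. poly_eval (g j) x \<ge> 0}"

definition measure_support :: "'a::topological_space measure \<Rightarrow> 'a set" where
  "measure_support \<mu> =
     {x \<in> space \<mu>. \<forall>U. open U \<longrightarrow> x \<in> U \<longrightarrow> 0 < emeasure \<mu> (U \<inter> space \<mu>)}"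

definition L2_space :: "'a measure \<Rightarrow> ('a \<Rightarrow> real) set" where
  "L2_space \<mu> = {f \<in> borel_measurable \<mu>. integrable \<mu> (\<lambda>x. (f x)\<^sup>2)}"

definition L2_norm :: "'a measure \<Rightarrow> ('a \<Rightarrow> real) \<Rightarrow> real" where
  "L2_norm \<mu> f = sqrt (LINT x|\<mu>. (f x)\<^sup>2)"

text \<open>
  Feasible points are pairs of a polynomial \<open>p\<close> and a family \<open>A\<close> of which only
  \<open>A 0, \<dots>, A m\<close> matter.
\<close>

definition feasible ::
  "nat \<Rightarrow> (nat \<Rightarrow> 'n::{finite,linorder} rpoly) \<Rightarrow> nat \<Rightarrow> 'n rpoly \<times> (nat \<Rightarrow> real mat) \<Rightarrow> bool" where
  "feasible m g d = (\<lambda>(p, A).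
     poly_deg p \<le> d \<and>
     p = gram_poly d (A 0) + (\<Sum>j=1..m. gram_poly (d - half_deg (g j)) (A j) * g j) \<and>
     A 0 \<in> psd_mats (num_monomials TYPE('n) d) \<and>
     (\<forall>j\<in>{1..m}. A j \<in> psd_mats (num_monomials TYPE('n) (d - half_deg (g j)))))"

definition objective ::
  "(real ^ 'n) measure \<Rightarrow> (real ^ 'n \<Rightarrow> real) \<Rightarrow> 'n::finite rpoly \<Rightarrow> real" where
  "objective \<mu> u p = (L2_norm \<mu> (\<lambda>x. u x - poly_eval p x))\<^sup>2"

definition optimal_solution ::
  "(real ^ 'n::{finite,linorder}) measure \<Rightarrow> (real ^ 'n::{finite,linorder} \<Rightarrow> real) \<Rightarrow>
   nat \<Rightarrow> (nat \<Rightarrow> 'n rpoly) \<Rightarrow>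
   nat \<Rightarrow> 'n rpoly \<times> (nat \<Rightarrow> real mat) \<Rightarrow> bool" where
  "optimal_solution \<mu> u m g d = is_arg_min (\<lambda>(p, A). objective \<mu> u p) (feasible m g d)"

subsection \<open>The monomial vector has the expected entries and length\<close>

lemma finite_mono_deg_eq: "finite {\<alpha>::'n::finite monomial. mono_deg \<alpha> = k}"
proof -
  have "Poly_Mapping.lookup ` {\<alpha>::'n monomial. mono_deg \<alpha> = k} \<subseteq> UNIV \<rightarrow>\<^sub>E {..k}"
  proof (clarsimp simp: PiE_def extensional_def Pi_def)
    fix \<alpha> :: "'n monomial" and i
    show "Poly_Mapping.lookup \<alpha> i \<le> mono_deg \<alpha>"
      unfolding mono_deg_def by (rule member_le_sum) auto
  qed
  then have "finite (Poly_Mapping.lookup ` {\<alpha>::'n monomial. mono_deg \<alpha> = k})"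
    by (rule finite_subset) (intro finite_PiE, auto)
  then show ?thesis
    by (rule finite_imageD) (simp add: inj_on_def poly_mapping_eqI)
qed

lemma card_mono_deg_eq:
  "card {\<alpha>::'n::finite monomial. mono_deg \<alpha> = k} = (k + CARD('n) - 1) choose k"
proof -
  obtain xs :: "'n list" where xs: "set xs = UNIV" "distinct xs"
    using finite_distinct_list[OF finite_class.finite_UNIV] by auto
  have len: "length xs = CARD('n)"
    using distinct_card[OF xs(2)] xs(1) by simp
  have "bij_betw (\<lambda>\<alpha>. map (Poly_Mapping.lookup \<alpha>) xs) {\<alpha>::'n monomial. mono_deg \<alpha> = k}
          {l. length l = CARD('n) \<and> sum_list l = k}"
    unfolding bij_betw_def
  proof
    show "inj_on (\<lambda>\<alpha>. map (Poly_Mapping.lookup \<alpha>) xs) {\<alpha>::'n monomial. mono_deg \<alpha> = k}"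
      using xs by (auto simp: inj_on_def intro!: poly_mapping_eqI)
    have sum: "sum_list (map f xs) = (\<Sum>i\<in>UNIV. f i)" for f :: "'n \<Rightarrow> nat"
      using sum_list_distinct_conv_sum_set[OF xs(2), of f] xs(1) by simp
    have "l \<in> (\<lambda>\<alpha>. map (Poly_Mapping.lookup \<alpha>) xs) ` {\<alpha>::'n monomial. mono_deg \<alpha> = k}"
      if l: "length l = CARD('n)" "sum_list l = k" for l
    proof -
      define f where "f = (\<lambda>i. the (map_of (zip xs l) i))"
      have f: "map f xs = l"
        using xs l len by (auto simp: f_def list_eq_iff_nth_eq map_of_zip_nth)
      have lk: "Poly_Mapping.lookup (Abs_poly_mapping f) = f"
        by (rule Poly_Mapping.lookup_Abs_poly_mapping) simp
      have "mono_deg (Abs_poly_mapping f) = k"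
        using l(2) f sum[of f] by (simp add: mono_deg_def lk)
      then show ?thesis
        using f lk by (intro image_eqI[of _ _ "Abs_poly_mapping f"]) auto
    qed
    then show "(\<lambda>\<alpha>. map (Poly_Mapping.lookup \<alpha>) xs) ` {\<alpha>::'n monomial. mono_deg \<alpha> = k} =
          {l. length l = CARD('n) \<and> sum_list l = k}"
      using len by (auto simp: sum mono_deg_def)
  qed
  then show ?thesis
    using card_length_sum_list[of "CARD('n)" k] bij_betw_same_card by fastforce
qed

lemma set_monomials_upto:
  "set (monomials_upto d :: 'n::{finite,linorder} monomial list) = {\<alpha>. mono_deg \<alpha> \<le> d}"
  by (auto simp: monomials_upto_def finite_mono_deg_eq)

lemma length_monomials_upto:
  "length (monomials_upto d :: 'n::{finite,linorder} monomial list) = num_monomials TYPE('n) d"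
proof -
  obtain c where c: "CARD('n) = Suc c"
    using not0_implies_Suc[of "CARD('n)"] by auto
  have "length (monomials_upto d :: 'n monomial list) = (\<Sum>k\<le>d. (c + k) choose k)"
    by (simp add: monomials_upto_def length_concat o_def card_mono_deg_eq c add.commute
        interv_sum_list_conv_sum_set_nat atLeast0LessThan flip: lessThan_Suc_atMost
        del: upt_Suc)
  also have "\<dots> = (CARD('n) + d) choose d"
    using sum_choose_lower[of c d] by (simp add: c)
  finally show ?thesis
    by (simp add: num_monomials_def)
qed

lemma distinct_monomials_upto: "distinct (monomials_upto d :: 'n::{finite,linorder} monomial list)"
proof (rule card_distinct)
  have "card {\<alpha>::'n monomial. mono_deg \<alpha> \<le> d} = (\<Sum>k\<le>d. card {\<alpha>::'n monomial. mono_deg \<alpha> = k})"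
  proof -
    have "{\<alpha>::'n monomial. mono_deg \<alpha> \<le> d} = (\<Union>k\<in>{..d}. {\<alpha>. mono_deg \<alpha> = k})"
      by auto
    then show ?thesis
      by (simp add: card_UN_disjoint finite_mono_deg_eq disjoint_iff)
  qed
  also have "\<dots> = length (monomials_upto d :: 'n monomial list)"
    by (simp add: monomials_upto_def length_concat o_def interv_sum_list_conv_sum_set_nat
        atLeast0LessThan flip: lessThan_Suc_atMost del: upt_Suc)
  finally show "card (set (monomials_upto d :: 'n monomial list)) = length (monomials_upto d :: 'n monomial list)"
    by (simp add: set_monomials_upto)
qed

lemma dim_basis_vec [simp]:
  "dim_vec (basis_vec d :: 'n::{finite,linorder} rpoly Matrix.vec) = num_monomials TYPE('n) d"
  by (simp add: basis_vec_def length_monomials_upto)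

end

theory Submission
  imports Defs
begin

text \<open>
  Existence of minimisers.  For fixed \<open>d\<close> the feasible polynomials are parametrised linearly by the
  entries of the Gram matrices \<open>A\<^sub>0, \<dots>, A\<^sub>m\<close>.  The admissible families of entries form a closed cone in a
  finite-dimensional space: positive semidefiniteness, symmetry and the degree bound are closed
  homogeneous conditions.  The objective is a quadratic polynomial on that space.  What has to be shown
  is that its sublevel sets on the cone are bounded.  For this consider \<open>\<integral>p d\<mu>\<close>, which is linear in
  the Gram entries.  A feasible \<open>p\<close> is a sum of terms that are nonnegative on \<open>\<Omega>\<close>; if its integral vanishes,
  then, as the support of the measure is \<open>\<Omega>\<close> and \<open>\<Omega>\<close> has interior points, every term vanishes on the
  interior of \<open>\<Omega>\<close>, and positive semidefiniteness together with the linear independence of monomials forces the Gram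
  matrices of all terms with \<open>g\<^sub>j \<noteq> 0\<close> to be \<open>0\<close> (\<open>assemble_vanishing_imp_0\<close>).  Thus the functional is
  positive on the cone minus the origin and dominates the size of the Gram entries there, while it is itself
  bounded in terms of the objective value (\<open>attains_min_on_closed_cone\<close>, \<open>ex_optimal_solution\<close>).

  Convergence.  By optimality it suffices to find, for every \<open>\<epsilon> > 0\<close>, one polynomial that is feasible for
  all large \<open>d\<close> and has error below \<open>\<epsilon>\<close>.  Squares \<open>h\<^sup>2\<close> are feasible as soon as \<open>d\<close> bounds the degrees
  of \<open>h\<close> and \<open>h\<^sup>2\<close> (\<open>square_feasible\<close>).  They are dense among the nonnegative elements of \<open>L\<^sup>2\<close>
  (\<open>square_approx\<close>): nonnegative continuous functions are dense by regularity of the measure, and the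
  square root of such a function is a uniform limit of polynomials on the compact set \<open>\<Omega>\<close>.
\<close>

section \<open>Polynomials as functions\<close>

definition mono_eval :: "'n::finite monomial \<Rightarrow> real ^ 'n \<Rightarrow> real" where
  "mono_eval \<alpha> x = (\<Prod>i\<in>UNIV. vec_nth x i ^ Poly_Mapping.lookup \<alpha> i)"

lemma poly_eval_conv_mono_eval:
  "poly_eval p x = (\<Sum>\<alpha>\<in>Poly_Mapping.keys p. Poly_Mapping.lookup p \<alpha> * mono_eval \<alpha> x)"
  by (simp add: poly_eval_def mono_eval_def)

lemma mono_eval_0 [simp]: "mono_eval 0 x = 1"
  by (simp add: mono_eval_def)

lemma mono_eval_add: "mono_eval (\<alpha> + \<beta>) x = mono_eval \<alpha> x * mono_eval \<beta> x"
  by (simp add: mono_eval_def lookup_add power_add prod.distrib)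

lemma poly_eval_0 [simp]: "poly_eval 0 x = 0"
  by (simp add: poly_eval_def)

lemma poly_eval_single [simp]: "poly_eval (Poly_Mapping.single \<alpha> c) x = c * mono_eval \<alpha> x"
  by (simp add: poly_eval_conv_mono_eval)

lemma poly_eval_const_poly [simp]: "poly_eval (const_poly c) x = c"
  by (simp add: const_poly_def)

lemma poly_eval_1 [simp]: "poly_eval 1 x = 1"
  using poly_eval_const_poly[of 1 x] by (simp add: const_poly_def)

lemma poly_eval_mono_poly [simp]: "poly_eval (mono_poly \<alpha>) x = mono_eval \<alpha> x"
  by (simp add: mono_poly_def)

lemma poly_eval_add [simp]: "poly_eval (p + q) x = poly_eval p x + poly_eval q x"
  unfolding poly_eval_conv_mono_eval
  by (rule setsum_keys_plus_distrib) (simp_all add: algebra_simps)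

lemma poly_eval_sum [simp]: "poly_eval (\<Sum>i\<in>I. f i) x = (\<Sum>i\<in>I. poly_eval (f i) x)"
  by (induction I rule: infinite_finite_induct) auto

lemma poly_mapping_sum_single:
  "(\<Sum>k\<in>Poly_Mapping.keys p. Poly_Mapping.single k (Poly_Mapping.lookup p k)) = p"
  by (rule poly_mapping_eqI)
     (auto simp: lookup_sum lookup_single when_def in_keys_iff)

lemma poly_eval_mult [simp]: "poly_eval (p * q) x = poly_eval p x * poly_eval q x"
proof -
  have "p * q = (\<Sum>k\<in>Poly_Mapping.keys p. \<Sum>l\<in>Poly_Mapping.keys q.
      Poly_Mapping.single (k + l) (Poly_Mapping.lookup p k * Poly_Mapping.lookup q l))"
    by (subst (1) poly_mapping_sum_single[symmetric, of p],
        subst (1) poly_mapping_sum_single[symmetric, of q])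
       (simp add: sum_product mult_single)
  then have "poly_eval (p * q) x = (\<Sum>k\<in>Poly_Mapping.keys p. \<Sum>l\<in>Poly_Mapping.keys q.
      (Poly_Mapping.lookup p k * mono_eval k x) * (Poly_Mapping.lookup q l * mono_eval l x))"
    by (simp add: mono_eval_add algebra_simps)
  then show ?thesis
    by (simp add: poly_eval_conv_mono_eval sum_product)
qed

lemma continuous_on_poly_eval [continuous_intros]: "continuous_on S (poly_eval p)"
  unfolding poly_eval_def by (intro continuous_intros)

text \<open>
  This carries the Stone--Weierstrass theorem, stated for \<^const>\<open>real_polynomial_function\<close>, over to
  polynomials given by their coefficients.
\<close>
lemma real_polynomial_function_imp_poly_eval:
  fixes f :: "real ^ 'n::finite \<Rightarrow> real"
  assumes "real_polynomial_function f"
  shows "\<exists>p. f = poly_eval p"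
  using assms
proof induction
  case (linear f)
  interpret bounded_linear f by fact
  define X :: "'n \<Rightarrow> 'n rpoly" where "X i = Poly_Mapping.single (Poly_Mapping.single i 1) 1" for i
  have X: "poly_eval (X i) x = vec_nth x i" for i x
  proof -
    have "(\<Prod>j\<in>UNIV. vec_nth x j ^ Poly_Mapping.lookup (Poly_Mapping.single i (1::nat)) j)
        = (\<Prod>j\<in>UNIV. if j = i then vec_nth x j else 1)"
      by (rule prod.cong) (auto simp: lookup_single when_def)
    then show ?thesis
      by (simp add: X_def mono_eval_def)
  qed
  have "f x = poly_eval (\<Sum>i\<in>UNIV. const_poly (f (axis i 1)) * X i) x" for x
  proof -
    have "f x = f (\<Sum>i\<in>UNIV. vec_nth x i *\<^sub>R axis i 1)"
      by (simp add: basis_expansion[of x, unfolded scalar_mult_eq_scaleR])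
    also have "\<dots> = (\<Sum>i\<in>UNIV. vec_nth x i * f (axis i 1))"
      by (simp add: sum scale)
    finally show ?thesis
      by (simp add: X mult.commute)
  qed
  then show ?case by blast
next
  case (const c)
  show ?case by (intro exI[of _ "const_poly c"]) auto
next
  case (add f g)
  then obtain p q where "f = poly_eval p" "g = poly_eval q" by blast
  then show ?case by (intro exI[of _ "p + q"]) auto
next
  case (mult f g)
  then obtain p q where "f = poly_eval p" "g = poly_eval q" by blast
  then show ?case by (intro exI[of _ "p * q"]) auto
qed

text \<open>
  Induction over the variables.  Fixing all variables but \<open>i\<close> leaves a univariate polynomial with
  infinitely many roots; each of its coefficients collects the monomials with one prescribed exponent
  at \<open>i\<close>, and these monomials stay distinct on the remaining variables.  The values are taken from a
  product of infinite sets \<open>X i\<close> because this form, unlike an arbitrary open set, restricts to fewer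
  variables.
\<close>
lemma sum_powers_eq_0_imp_coeff_eq_0:
  fixes c :: "'a \<Rightarrow> real" and e :: "'a \<Rightarrow> 'n \<Rightarrow> nat"
  assumes "finite T" "finite S"
    and "inj_on (\<lambda>a. restrict (e a) T) S"
    and "\<And>i. i \<in> T \<Longrightarrow> infinite (X i)"
    and "\<And>x. (\<And>i. i \<in> T \<Longrightarrow> x i \<in> X i) \<Longrightarrow> (\<Sum>a\<in>S. c a * (\<Prod>i\<in>T. x i ^ e a i)) = 0"
    and "a \<in> S"
  shows "c a = 0"
  using assms
proof (induction T arbitrary: S c a rule: finite_induct)
  case empty
  then have "S = {a}" by (auto simp: inj_on_def)
  with empty.prems(4) show ?case by simp
next
  case (insert i T)
  define k where "k = e a i"
  define S' where "S' = {b \<in> S. e b i = k}"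
  show ?case
  proof (rule insert.IH[of S'])
    show "finite S'" "a \<in> S'"
      using insert.prems by (auto simp: S'_def k_def)
    show "inj_on (\<lambda>b. restrict (e b) T) S'"
    proof (rule inj_onI)
      fix b b' assume b: "b \<in> S'" "b' \<in> S'" "restrict (e b) T = restrict (e b') T"
      have "e b j = e b' j" if "j \<in> insert i T" for j
        using fun_cong[OF b(3), of j] b(1,2) that by (auto simp: S'_def)
      then have "restrict (e b) (insert i T) = restrict (e b') (insert i T)"
        by (auto simp: restrict_def)
      then show "b = b'"
        using inj_onD[OF insert.prems(2), of b b'] b by (simp add: S'_def)
    qed
    show "infinite (X j)" if "j \<in> T" for j
      using that insert.prems by auto
    fix x assume x: "\<And>j. j \<in> T \<Longrightarrow> x j \<in> X j"
    define N where "N = Max ((\<lambda>b. e b i) ` S)"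
    define q where "q n = (\<Sum>b\<in>{b\<in>S. e b i = n}. c b * (\<Prod>j\<in>T. x j ^ e b j))" for n
    have N: "e b i \<le> N" if "b \<in> S" for b
      using that insert.prems by (auto simp: N_def)
    have "(\<Sum>n\<le>N. q n * z ^ n) = 0" if z: "z \<in> X i" for z
    proof -
      have "0 = (\<Sum>b\<in>S. c b * (\<Prod>j\<in>insert i T. (x(i := z)) j ^ e b j))"
        using x z by (intro insert.prems(4)[symmetric]) auto
      also have "\<dots> = (\<Sum>b\<in>S. c b * (\<Prod>j\<in>T. x j ^ e b j) * z ^ e b i)"
      proof (rule sum.cong[OF refl])
        fix b
        have "(\<Prod>j\<in>T. (x(i := z)) j ^ e b j) = (\<Prod>j\<in>T. x j ^ e b j)"
          using insert.hyps by (intro prod.cong) auto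
        then show "c b * (\<Prod>j\<in>insert i T. (x(i := z)) j ^ e b j)
            = c b * (\<Prod>j\<in>T. x j ^ e b j) * z ^ e b i"
          using insert.hyps by simp
      qed
      also have "\<dots> = (\<Sum>n\<le>N. \<Sum>b\<in>{b\<in>S. e b i = n}. c b * (\<Prod>j\<in>T. x j ^ e b j) * z ^ e b i)"
        using N insert.prems(1) by (intro sum.group[symmetric]) auto
      also have "\<dots> = (\<Sum>n\<le>N. q n * z ^ n)"
        unfolding q_def sum_distrib_right by (intro sum.cong) auto
      finally show ?thesis by simp
    qed
    then have "X i \<subseteq> {z. (\<Sum>n\<le>N. q n * z ^ n) = 0}" by auto
    then have "infinite {z. (\<Sum>n\<le>N. q n * z ^ n) = 0}"
      using insert.prems(3)[of i] finite_subset by blast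
    then have "q k = 0"
      using polyfun_finite_roots[where n = N and c = q] N[OF insert.prems(5)] k_def by auto
    then show "(\<Sum>b\<in>S'. c b * (\<Prod>j\<in>T. x j ^ e b j)) = 0"
      by (simp add: q_def S'_def)
  qed
qed

text \<open>
  An open set contains an open box, that is, a product of infinite intervals.
\<close>
lemma mono_eval_linear_independent:
  fixes V :: "(real ^ 'n::finite) set"
  assumes "open V" "V \<noteq> {}" "finite I" "inj_on b I"
    and "\<And>x. x \<in> V \<Longrightarrow> (\<Sum>i\<in>I. c i * mono_eval (b i) x) = 0"
    and "i \<in> I"
  shows "c i = 0"
proof -
  obtain x0 where "x0 \<in> V" using assms by auto
  then obtain a b' where ab: "x0 \<in> box a b'" "box a b' \<subseteq> V"
    using open_contains_box[OF assms(1)] by metis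
  have ab': "vec_nth a j < vec_nth b' j" for j
    using ab(1) unfolding mem_box_cart by (meson order.strict_trans)
  show ?thesis
  proof (rule sum_powers_eq_0_imp_coeff_eq_0[where T = UNIV and S = I and e = "\<lambda>i. Poly_Mapping.lookup (b i)"
        and X = "\<lambda>j. {vec_nth a j<..<vec_nth b' j}"])
    show "inj_on (\<lambda>i. restrict (Poly_Mapping.lookup (b i)) UNIV) I"
      using assms(4) by (auto simp: inj_on_def restrict_def Poly_Mapping.lookup_inject)
    show "infinite {vec_nth a j<..<vec_nth b' j}" for j
      using ab' by simp
    fix x assume "\<And>j. j \<in> UNIV \<Longrightarrow> x j \<in> {vec_nth a j<..<vec_nth b' j}"
    then have "(\<chi> j. x j) \<in> V"
      using ab(2) by (auto simp: mem_box_cart subset_eq)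
    from assms(5)[OF this]
    show "(\<Sum>i\<in>I. c i * (\<Prod>j\<in>UNIV. x j ^ Poly_Mapping.lookup (b i) j)) = 0"
      by (simp add: mono_eval_def)
  qed (use assms in auto)
qed

lemma poly_eq_0_if_eval_eq_0_on_open:
  assumes "open V" "V \<noteq> {}" "\<And>x. x \<in> V \<Longrightarrow> poly_eval p x = 0"
  shows "p = 0"
proof (rule poly_mapping_eqI)
  fix \<alpha>
  show "Poly_Mapping.lookup p \<alpha> = Poly_Mapping.lookup 0 \<alpha>"
  proof (cases "\<alpha> \<in> Poly_Mapping.keys p")
    case True
    then show ?thesis
      using mono_eval_linear_independent[OF assms(1,2), of "Poly_Mapping.keys p" id "Poly_Mapping.lookup p" \<alpha>]
        assms(3) by (simp add: poly_eval_conv_mono_eval)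
  qed (simp add: in_keys_iff)
qed

text \<open>
  In this form a degree bound is a family of linear equations in the coefficients.
\<close>
lemma poly_deg_le_iff: "poly_deg p \<le> d \<longleftrightarrow> (\<forall>\<alpha>. d < mono_deg \<alpha> \<longrightarrow> Poly_Mapping.lookup p \<alpha> = 0)"
  unfolding poly_deg_def by (auto simp: in_keys_iff not_le[symmetric])

lemma lookup_const_poly_mult:
  "Poly_Mapping.lookup (const_poly c * q) \<alpha> = c * Poly_Mapping.lookup q \<alpha>"
  unfolding const_poly_def mult_map_scale_conv_mult[symmetric]
  by (simp add: Poly_Mapping.map.rep_eq when_def)

section \<open>Minimisation over closed cones of finite dimension\<close>

lemma compact_box_fun: "compact {w::'i \<Rightarrow> real. \<forall>i. w i \<in> {-B..B}}"
proof -
  have "{w::'i \<Rightarrow> real. \<forall>i. w i \<in> {-B..B}} = PiE UNIV (\<lambda>_. {-B..B})"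
    by (auto simp: PiE_def)
  then show ?thesis
    using compactin_PiE[of "\<lambda>_. euclidean" "UNIV :: 'i set" "\<lambda>_. {-B..B}"]
    by (simp add: euclidean_product_topology)
qed

text \<open>
  Boundedness in every coordinate suffices even for infinitely many coordinates, by Tychonoff's theorem.
  Functions on a whole index type serve as vectors here; finite dimension is expressed by requiring all
  coordinates outside a finite set to vanish.
\<close>
lemma compact_bounded_fun:
  fixes K :: "('i \<Rightarrow> real) set"
  assumes "closed K" "\<And>w i. w \<in> K \<Longrightarrow> \<bar>w i\<bar> \<le> B"
  shows "compact K"
proof -
  have "K = K \<inter> {w. \<forall>i. w i \<in> {-B..B}}"
    using assms(2) by (auto simp: abs_le_iff minus_le_iff)
  then show ?thesis
    using closed_Int_compact[OF assms(1) compact_box_fun] by metis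
qed

text \<open>
  On the part of the cone with \<open>\<ell>\<^sup>1\<close> norm \<open>1\<close>, a compact set, the linear functional given by \<open>l\<close> has a
  positive minimum \<open>c\<close>; by homogeneity it dominates \<open>c\<close> times the norm on the whole cone.  Hence the
  sublevel set of \<open>Q\<close> at the value \<open>Q 0\<close>, where the functional is at most \<open>M\<close>, is bounded and therefore
  compact.
\<close>
lemma attains_min_on_closed_cone:
  fixes K :: "('i \<Rightarrow> real) set" and Q :: "('i \<Rightarrow> real) \<Rightarrow> real" and l :: "'i \<Rightarrow> real"
  assumes I: "finite I" and K: "closed K" and K0: "(\<lambda>_. 0) \<in> K"
    and supp: "\<And>w i. w \<in> K \<Longrightarrow> i \<notin> I \<Longrightarrow> w i = 0"
    and cone: "\<And>w t. w \<in> K \<Longrightarrow> 0 \<le> t \<Longrightarrow> (\<lambda>i. t * w i) \<in> K"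
    and pos: "\<And>w. w \<in> K \<Longrightarrow> w \<noteq> (\<lambda>_. 0) \<Longrightarrow> 0 < (\<Sum>i\<in>I. l i * w i)"
    and cont: "continuous_on UNIV Q"
    and bdd: "\<And>w. w \<in> K \<Longrightarrow> Q w \<le> Q (\<lambda>_. 0) \<Longrightarrow> (\<Sum>i\<in>I. l i * w i) \<le> M"
  shows "\<exists>w\<in>K. \<forall>w'\<in>K. Q w \<le> Q w'"
proof -
  define L where "L w = (\<Sum>i\<in>I. l i * w i)" for w
  define N where "N w = (\<Sum>i\<in>I. \<bar>w i\<bar>)" for w :: "'i \<Rightarrow> real"
  have contL: "continuous_on UNIV L" and contN: "continuous_on UNIV N"
    unfolding L_def N_def by (intro continuous_intros; simp)+
  have le_N: "\<bar>w i\<bar> \<le> N w" if "w \<in> K" for w i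
    using supp[OF that, of i] I
    by (cases "i \<in> I") (auto simp: N_def sum_nonneg intro: member_le_sum)
  define S where "S = K \<inter> {w. N w = 1}"
  have "closed S"
    unfolding S_def
    by (intro closed_Int K closed_Collect_eq contN continuous_on_const)
  then have "compact S"
    using le_N by (intro compact_bounded_fun[of _ 1]) (auto simp: S_def, metis)
  obtain c where c: "0 < c" "\<And>w. w \<in> S \<Longrightarrow> c \<le> L w"
  proof (cases "S = {}")
    case True
    then show ?thesis using that[of 1] by auto
  next
    case False
    obtain w0 where w0: "w0 \<in> S" "\<forall>w\<in>S. L w0 \<le> L w"
      using continuous_attains_inf[OF \<open>compact S\<close> False] continuous_on_subset[OF contL] by blast
    have "w0 \<noteq> (\<lambda>_. 0)"
      using w0(1) by (auto simp: S_def N_def)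
    then have "0 < L w0"
      using pos[of w0] w0(1) by (auto simp: S_def L_def)
    then show ?thesis using that[of "L w0"] w0 by auto
  qed
  have cN: "c * N w \<le> L w" if "w \<in> K" for w
  proof (cases "N w = 0")
    case True
    then have "w i = 0" for i
      using le_N[OF that, of i] by simp
    then show ?thesis using True by (simp add: L_def)
  next
    case False
    then have N: "0 < N w" using I by (auto simp: N_def sum_nonneg order_less_le)
    have "(\<lambda>i. (1 / N w) * w i) \<in> K"
      using cone[OF that, of "1 / N w"] N by simp
    moreover have "N (\<lambda>i. (1 / N w) * w i) = 1"
    proof -
      have "N (\<lambda>i. (1 / N w) * w i) = (1 / N w) * N w"
        unfolding N_def[of "\<lambda>i. (1 / N w) * w i"] using N
        by (simp add: abs_mult flip: sum_divide_distrib) (simp add: N_def)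
      then show ?thesis using N by simp
    qed
    ultimately have "c \<le> L (\<lambda>i. (1 / N w) * w i)"
      using c(2) by (auto simp: S_def)
    also have "\<dots> = L w / N w"
      by (simp add: L_def sum_divide_distrib)
    finally show ?thesis using N by (simp add: field_simps)
  qed
  define D where "D = K \<inter> {w. Q w \<le> Q (\<lambda>_. 0)}"
  have "closed D"
    unfolding D_def by (intro closed_Int K closed_Collect_le cont continuous_on_const)
  moreover have "\<bar>w i\<bar> \<le> M / c" if "w \<in> D" for w i
  proof -
    have "c * \<bar>w i\<bar> \<le> c * N w"
      using le_N that c(1) by (auto simp: D_def)
    also have "\<dots> \<le> M"
      using cN[of w] bdd[of w] that by (auto simp: D_def L_def)
    finally show ?thesis using c(1) by (simp add: field_simps)
  qed
  ultimately have "compact D"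
    by (rule compact_bounded_fun)
  moreover have "(\<lambda>_. 0) \<in> D" using K0 by (simp add: D_def)
  ultimately obtain w where w: "w \<in> D" "\<forall>w'\<in>D. Q w \<le> Q w'"
    using continuous_attains_inf[of D Q] continuous_on_subset[OF cont] by blast
  have "Q w \<le> Q w'" if "w' \<in> K" for w'
    using w that by (cases "Q w' \<le> Q (\<lambda>_. 0)") (auto simp: D_def)
  then show ?thesis using w(1) by (auto simp: D_def)
qed

section \<open>Square-integrable functions\<close>

lemma integrable_L2_mult:
  assumes "u \<in> L2_space M" "v \<in> L2_space M"
  shows "integrable M (\<lambda>x. u x * v x :: real)"
proof (rule Bochner_Integration.integrable_bound)
  show "integrable M (\<lambda>x. (u x)\<^sup>2 + (v x)\<^sup>2)"
    using assms by (simp add: L2_space_def)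
  show "(\<lambda>x. u x * v x) \<in> borel_measurable M"
    using assms by (auto simp: L2_space_def)
  have "\<bar>u x * v x\<bar> \<le> (u x)\<^sup>2 + (v x)\<^sup>2" for x
  proof -
    have "2 * (\<bar>u x\<bar> * \<bar>v x\<bar>) \<le> (u x)\<^sup>2 + (v x)\<^sup>2"
      using sum_squares_bound[of "\<bar>u x\<bar>" "\<bar>v x\<bar>"] by simp
    moreover have "0 \<le> \<bar>u x\<bar> * \<bar>v x\<bar>" by simp
    ultimately show ?thesis unfolding abs_mult by linarith
  qed
  then show "AE x in M. norm (u x * v x) \<le> norm ((u x)\<^sup>2 + (v x)\<^sup>2)"
    by simp
qed

lemma L2_space_add:
  assumes "u \<in> L2_space M" "v \<in> L2_space M"
  shows "(\<lambda>x. u x + v x) \<in> L2_space M"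
proof -
  have "(\<lambda>x. (u x + v x)\<^sup>2) = (\<lambda>x. (u x)\<^sup>2 + (v x)\<^sup>2 + 2 * (u x * v x))"
    by (auto simp: power2_eq_square algebra_simps)
  then show ?thesis
    using assms integrable_L2_mult[OF assms] by (auto simp: L2_space_def)
qed

lemma L2_space_cmult:
  assumes "u \<in> L2_space M"
  shows "(\<lambda>x. c * u x) \<in> L2_space M"
  using assms by (auto simp: L2_space_def power_mult_distrib)

lemma L2_space_diff:
  assumes "u \<in> L2_space M" "v \<in> L2_space M"
  shows "(\<lambda>x. u x - v x) \<in> L2_space M"
  using L2_space_add[OF assms(1) L2_space_cmult[OF assms(2), of "-1"]] by simp

text \<open>
  A weak triangle inequality for squared distances, from \<open>(a + b)\<^sup>2 \<le> 2 a\<^sup>2 + 2 b\<^sup>2\<close>.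
\<close>
lemma L2_error_triangle:
  assumes "u \<in> L2_space M" "v \<in> L2_space M" "w \<in> L2_space M"
  shows "(LINT x|M. (u x - w x)\<^sup>2) \<le> 2 * (LINT x|M. (u x - v x)\<^sup>2) + 2 * (LINT x|M. (v x - w x)\<^sup>2)"
proof -
  have i: "integrable M (\<lambda>x. (u x - w x)\<^sup>2)" "integrable M (\<lambda>x. (u x - v x)\<^sup>2)"
    "integrable M (\<lambda>x. (v x - w x)\<^sup>2)"
    using assms L2_space_diff by (auto simp: L2_space_def)
  have "(u x - w x)\<^sup>2 \<le> 2 * (u x - v x)\<^sup>2 + 2 * (v x - w x)\<^sup>2" for x
    using sum_squares_bound[of "u x - v x" "v x - w x"]
    by (simp add: power2_eq_square algebra_simps)
  then have "(LINT x|M. (u x - w x)\<^sup>2) \<le> (LINT x|M. 2 * (u x - v x)\<^sup>2 + 2 * (v x - w x)\<^sup>2)"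
    using i by (intro integral_mono) auto
  then show ?thesis using i by simp
qed

text \<open>
  Expanding the square exhibits the least squares error as a quadratic polynomial in the finitely many
  coefficients of the linear combination, whence its continuity.
\<close>
lemma L2_error_linear_comb:
  assumes I: "finite I" and u: "u \<in> L2_space M" and f: "\<And>i. i \<in> I \<Longrightarrow> f i \<in> L2_space M"
  shows "(LINT x|M. (u x - (\<Sum>i\<in>I. w i * f i x))\<^sup>2) =
    (LINT x|M. (u x)\<^sup>2) - 2 * (\<Sum>i\<in>I. w i * (LINT x|M. u x * f i x))
    + (\<Sum>i\<in>I. \<Sum>j\<in>I. w i * w j * (LINT x|M. f i x * f j x))"
proof -
  have "(u x - (\<Sum>i\<in>I. w i * f i x))\<^sup>2 =
      (u x)\<^sup>2 - 2 * (\<Sum>i\<in>I. w i * (u x * f i x)) + (\<Sum>i\<in>I. \<Sum>j\<in>I. w i * w j * (f i x * f j x))" for x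
  proof -
    have "(\<Sum>i\<in>I. w i * f i x)\<^sup>2 = (\<Sum>i\<in>I. \<Sum>j\<in>I. w i * w j * (f i x * f j x))"
      unfolding power2_eq_square sum_product by (intro sum.cong refl) (simp add: algebra_simps)
    moreover have "u x * (\<Sum>i\<in>I. w i * f i x) = (\<Sum>i\<in>I. w i * (u x * f i x))"
      unfolding sum_distrib_left by (intro sum.cong refl) (simp add: algebra_simps)
    ultimately show ?thesis
      by (simp add: power2_diff)
  qed
  moreover have "integrable M (\<lambda>x. (u x)\<^sup>2)"
    using u by (simp add: L2_space_def)
  ultimately show ?thesis
    using integrable_L2_mult[OF u f] integrable_L2_mult[OF f f]
    by simp
qed

lemma continuous_on_L2_error:
  assumes I: "finite I" and u: "u \<in> L2_space M" and f: "\<And>i. i \<in> I \<Longrightarrow> f i \<in> L2_space M"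
  shows "continuous_on UNIV (\<lambda>w. LINT x|M. (u x - (\<Sum>i\<in>I. w i * f i x))\<^sup>2)"
proof -
  have eq: "(\<lambda>w. LINT x|M. (u x - (\<Sum>i\<in>I. w i * f i x))\<^sup>2) =
    (\<lambda>w. (LINT x|M. (u x)\<^sup>2) - 2 * (\<Sum>i\<in>I. w i * (LINT x|M. u x * f i x))
      + (\<Sum>i\<in>I. \<Sum>j\<in>I. w i * w j * (LINT x|M. f i x * f j x)))"
    by (rule ext) (rule L2_error_linear_comb[OF assms])
  show ?thesis
    unfolding eq
    by (intro continuous_on_add continuous_on_diff continuous_on_const continuous_on_mult
        continuous_on_sum continuous_on_product_coordinates)
qed

section \<open>Density of nonnegative continuous functions\<close>

locale compactly_supported_finite_measure = finite_measure \<mu>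
  for \<mu> :: "'a::euclidean_space measure" and \<Omega> +
  assumes compact_Omega: "compact \<Omega>"
    and sets_mu: "sets \<mu> = sets (restrict_space borel \<Omega>)"
begin

lemma space_mu: "space \<mu> = \<Omega>"
  using sets_eq_imp_space_eq[OF sets_mu] by (simp add: space_restrict_space)

lemma Int_Omega_in_sets: "C \<in> sets borel \<Longrightarrow> C \<inter> \<Omega> \<in> sets \<mu>"
  unfolding sets_mu sets_restrict_space by (rule image_eqI[of _ _ C]) auto

lemma continuous_in_L2:
  assumes "continuous_on UNIV (f :: 'a \<Rightarrow> real)"
  shows "f \<in> L2_space \<mu>"
proof -
  have m: "f \<in> borel_measurable \<mu>"
    using measurable_restrict_space1[OF borel_measurable_continuous_onI[OF assms], of \<Omega>]
      measurable_cong_sets[OF sets_mu refl] by blast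
  have "bounded ((\<lambda>x. (f x)\<^sup>2) ` \<Omega>)"
    using assms continuous_on_subset
    by (intro compact_imp_bounded compact_continuous_image compact_Omega continuous_intros) auto
  then obtain B where "\<And>x. x \<in> \<Omega> \<Longrightarrow> norm ((f x)\<^sup>2) \<le> B"
    unfolding bounded_iff by blast
  then have "integrable \<mu> (\<lambda>x. (f x)\<^sup>2)"
    using m by (intro integrable_const_bound[of _ B]) (auto simp: space_mu intro!: AE_I2)
  then show ?thesis using m by (simp add: L2_space_def)
qed

text \<open>
  The push-forward of \<open>\<mu>\<close> under the inclusion of \<open>\<Omega>\<close> is a finite Borel measure on the whole space,
  hence outer regular.
\<close>
lemma outer_approx:
  assumes "B \<in> sets borel" "0 < e"
  obtains U where "open U" "B \<subseteq> U" "measure \<mu> ((U - B) \<inter> \<Omega>) < e"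
proof -
  have id: "(\<lambda>x. x) \<in> measurable \<mu> borel"
    unfolding measurable_cong_sets[OF sets_mu refl] by (rule measurable_restrict_space1) simp
  define \<nu> where "\<nu> = distr \<mu> borel (\<lambda>x. x)"
  interpret \<nu>: finite_measure \<nu>
    unfolding \<nu>_def by (rule finite_measure_distr[OF id])
  have meas: "measure \<nu> C = measure \<mu> (C \<inter> \<Omega>)" if "C \<in> sets borel" for C
    unfolding \<nu>_def using that id by (subst measure_distr) (auto simp: space_mu)
  have "emeasure \<nu> B < emeasure \<nu> B + ennreal e"
    using assms(2) by (simp add: \<nu>.emeasure_eq_measure flip: ennreal_plus) (simp add: ennreal_lessI)
  then have "(INF U \<in> {U. B \<subseteq> U \<and> open U}. emeasure \<nu> U) < emeasure \<nu> B + ennreal e"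
  proof (subst outer_regular[symmetric])
    show "sets \<nu> = sets borel" by (simp add: \<nu>_def)
    show "emeasure \<nu> (space \<nu>) \<noteq> \<infinity>" by (simp add: \<nu>.emeasure_finite)
  qed (use assms(1) \<open>emeasure \<nu> B < emeasure \<nu> B + ennreal e\<close> in auto)
  then obtain U where U: "open U" "B \<subseteq> U" "emeasure \<nu> U < emeasure \<nu> B + ennreal e"
    by (auto simp: INF_less_iff)
  have "measure \<nu> U < measure \<nu> B + e"
    using U(3) assms(2) by (simp add: \<nu>.emeasure_eq_measure ennreal_less_iff flip: ennreal_plus)
  moreover have "measure \<nu> (U - B) = measure \<nu> U - measure \<nu> B"
    using U assms(1) by (intro \<nu>.finite_measure_Diff) (auto simp: \<nu>_def)
  moreover have "measure \<nu> (U - B) = measure \<mu> ((U - B) \<inter> \<Omega>)"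
    using U assms(1) by (intro meas) auto
  ultimately show ?thesis using that U by auto
qed

text \<open>
  Enclose the set between a closed set \<open>-V\<close> and an open set \<open>U\<close> that differ by little in measure, and
  interpolate with an Urysohn function; the error is at most \<open>1\<close> and is supported on the difference.
\<close>
lemma indicator_approx:
  assumes "A \<in> sets \<mu>" "0 < e"
  shows "\<exists>f. continuous_on UNIV f \<and> (\<forall>x. 0 \<le> f x) \<and> (LINT x|\<mu>. (indicator A x - f x)\<^sup>2) < (e::real)"
proof -
  obtain B where B: "B \<in> sets borel" "A = B \<inter> \<Omega>"
    using assms(1) unfolding sets_mu by (auto simp: sets_restrict_space)
  obtain U where U: "open U" "B \<subseteq> U" "measure \<mu> ((U - B) \<inter> \<Omega>) < e / 2"
    using outer_approx[OF B(1), of "e/2"] assms(2) by auto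
  obtain V where V: "open V" "-B \<subseteq> V" "measure \<mu> ((V - (-B)) \<inter> \<Omega>) < e / 2"
    using outer_approx[of "-B" "e/2"] B(1) assms(2) by auto
  have disj: "-V \<inter> -U = {}" using U(2) V(2) by auto
  obtain f :: "'a \<Rightarrow> real" where f: "continuous_on UNIV f" "\<And>x. f x \<in> closed_segment 1 0"
    "\<And>x. f x = 1 \<longleftrightarrow> x \<in> -V" "\<And>x. f x = 0 \<longleftrightarrow> x \<in> -U"
    using disj U(1) V(1) by (rule_tac Urysohn_strong[of "-V" "-U" "1::real" 0]) (auto simp: closed_Compl)
  have f01: "0 \<le> f x" "f x \<le> 1" for x
    using f(2)[of x] by (auto simp: closed_segment_eq_real_ivl)
  define W where "W = (U - B) \<union> (V - (-B))"
  have W: "W \<inter> \<Omega> \<in> sets \<mu>"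
    unfolding W_def using U(1) V(1) B(1) by (intro Int_Omega_in_sets) auto
  have le: "(indicator A x - f x)\<^sup>2 \<le> indicator (W \<inter> \<Omega>) x" if "x \<in> space \<mu>" for x
  proof (cases "x \<in> W")
    case True
    have "\<bar>indicator A x - f x\<bar> \<le> 1"
      using f01[of x] by (auto simp: indicator_def)
    then show ?thesis
      using True that by (simp add: space_mu abs_square_le_1)
  next
    case False
    then have "indicator A x = f x"
      using f(3)[of x] f(4)[of x] U(2) V(2) that B(2) by (auto simp: W_def indicator_def space_mu)
    then show ?thesis by simp
  qed
  have "(\<lambda>x. indicator A x) \<in> L2_space \<mu>"
    using assms(1) by (auto simp: L2_space_def power2_eq_square emeasure_eq_measure simp flip: indicator_inter_arith)
  then have "integrable \<mu> (\<lambda>x. (indicator A x - f x)\<^sup>2)"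
    using L2_space_diff[OF _ continuous_in_L2[OF f(1)]] by (auto simp: L2_space_def)
  then have "(LINT x|\<mu>. (indicator A x - f x)\<^sup>2) \<le> (LINT x|\<mu>. indicator (W \<inter> \<Omega>) x)"
    using le W by (intro integral_mono) (auto simp: emeasure_eq_measure)
  also have "\<dots> = measure \<mu> (W \<inter> \<Omega>)"
    using W by (simp add: space_mu)
  also have "W \<inter> \<Omega> = ((U - B) \<inter> \<Omega>) \<union> ((V - (-B)) \<inter> \<Omega>)"
    by (auto simp: W_def)
  also have "measure \<mu> \<dots> \<le> measure \<mu> ((U - B) \<inter> \<Omega>) + measure \<mu> ((V - (-B)) \<inter> \<Omega>)"
    using U V B by (intro measure_Un_le Int_Omega_in_sets) auto
  also have "\<dots> < e" using U(3) V(3) by simp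
  finally show ?thesis using f f01 by blast
qed

text \<open>
  Keeping the approximants nonnegative is what later permits taking their square roots.  Indicators are
  dealt with above, and monotone limits by dominated convergence with majorant \<open>u\<^sup>2\<close>.
\<close>
lemma nonneg_L2_approx:
  assumes "u \<in> borel_measurable \<mu>" "\<And>x. 0 \<le> u x" "integrable \<mu> (\<lambda>x. (u x)\<^sup>2)" "0 < e"
  shows "\<exists>f. continuous_on UNIV f \<and> (\<forall>x. 0 \<le> f x) \<and> (LINT x|\<mu>. (u x - f x)\<^sup>2) < (e::real)"
  using assms
proof (induction u arbitrary: e rule: borel_measurable_induct_real)
  case (set A)
  then show ?case by (intro indicator_approx)
next
  case (mult u c)
  show ?case
  proof (cases "c = 0")
    case True
    then show ?thesis using mult by (intro exI[of _ "\<lambda>_. 0"]) auto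
  next
    case False
    then have "integrable \<mu> (\<lambda>x. (u x)\<^sup>2)"
      using mult.prems by (simp add: power_mult_distrib)
    then obtain f where f: "continuous_on UNIV f" "\<forall>x. 0 \<le> f x" "(LINT x|\<mu>. (u x - f x)\<^sup>2) < e / c\<^sup>2"
      using mult.IH[of "e / c\<^sup>2"] mult.prems False by auto
    have "(LINT x|\<mu>. (c * u x - c * f x)\<^sup>2) = c\<^sup>2 * (LINT x|\<mu>. (u x - f x)\<^sup>2)"
      by (simp add: right_diff_distrib[symmetric] power_mult_distrib)
    also have "\<dots> < e"
      using f(3) False by (simp add: field_simps)
    finally show ?thesis
      using f mult.hyps by (intro exI[of _ "\<lambda>x. c * f x"]) (auto intro!: continuous_intros)
  qed
next
  case (add u v)
  \<comment> \<open>both summands are dominated by their sum, since they are nonnegative\<close>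
  have *: "integrable \<mu> (\<lambda>x. (u x)\<^sup>2)" "integrable \<mu> (\<lambda>x. (v x)\<^sup>2)"
    by (rule Bochner_Integration.integrable_bound[OF add.prems(1)];
        use add.hyps in \<open>auto intro!: AE_I2 power_mono\<close>)+
  obtain f where f: "continuous_on UNIV f" "\<forall>x. 0 \<le> f x" "(LINT x|\<mu>. (u x - f x)\<^sup>2) < e / 4"
    using add.IH(1)[OF *(1), of "e/4"] add.prems by auto
  obtain g where g: "continuous_on UNIV g" "\<forall>x. 0 \<le> g x" "(LINT x|\<mu>. (v x - g x)\<^sup>2) < e / 4"
    using add.IH(2)[OF *(2), of "e/4"] add.prems by auto
  have L2: "u \<in> L2_space \<mu>" "v \<in> L2_space \<mu>" "f \<in> L2_space \<mu>" "g \<in> L2_space \<mu>"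
    using add.hyps * f g continuous_in_L2 by (auto simp: L2_space_def)
  have "(LINT x|\<mu>. ((v x + u x) - (g x + f x))\<^sup>2)
      \<le> 2 * (LINT x|\<mu>. ((v x + u x) - (g x + u x))\<^sup>2) + 2 * (LINT x|\<mu>. ((g x + u x) - (g x + f x))\<^sup>2)"
    by (intro L2_error_triangle L2_space_add L2)
  also have "\<dots> < e" using f(3) g(3) by simp
  finally show ?case
    using f g by (intro exI[of _ "\<lambda>x. g x + f x"]) (auto intro!: continuous_intros)
next
  case (seq U)
  have U_le: "U i x \<le> u x" if "x \<in> space \<mu>" for i x
    using seq.hyps(3) seq.hyps(4)[OF that]
    by (intro incseq_le) (auto simp: incseq_def le_fun_def)
  have sq: "integrable \<mu> (\<lambda>x. (U i x)\<^sup>2)" for i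
    using seq.hyps(1,2) U_le
    by (intro Bochner_Integration.integrable_bound[OF seq.prems(1)]) (auto intro!: AE_I2 power_mono)
  have um: "u \<in> borel_measurable \<mu>"
    using seq.hyps(4) seq.hyps(1) by (rule borel_measurable_LIMSEQ_real)
  have "(\<lambda>i. LINT x|\<mu>. (u x - U i x)\<^sup>2) \<longlonglongrightarrow> (LINT x|\<mu>. 0)"
  proof (rule integral_dominated_convergence[where w = "\<lambda>x. (u x)\<^sup>2"])
    show "AE x in \<mu>. (\<lambda>i. (u x - U i x)\<^sup>2) \<longlonglongrightarrow> 0"
    proof (rule AE_I2)
      fix x assume "x \<in> space \<mu>"
      from seq.hyps(4)[OF this] have "(\<lambda>i. (u x - U i x)\<^sup>2) \<longlonglongrightarrow> (u x - u x)\<^sup>2"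
        by (intro tendsto_intros)
      then show "(\<lambda>i. (u x - U i x)\<^sup>2) \<longlonglongrightarrow> 0" by simp
    qed
    show "AE x in \<mu>. norm ((u x - U i x)\<^sup>2) \<le> (u x)\<^sup>2" for i
      using U_le seq.hyps(2) by (auto intro!: AE_I2 power_mono)
  qed (use um seq in auto)
  then have "eventually (\<lambda>i. (LINT x|\<mu>. (u x - U i x)\<^sup>2) < e / 4) sequentially"
    using seq.prems(2) by (intro order_tendstoD(2)[where y = 0]) auto
  then obtain i where i: "(LINT x|\<mu>. (u x - U i x)\<^sup>2) < e / 4"
    by (auto simp: eventually_sequentially)
  obtain f where f: "continuous_on UNIV f" "\<forall>x. 0 \<le> f x" "(LINT x|\<mu>. (U i x - f x)\<^sup>2) < e / 4"
    using seq.IH[OF sq[of i], of "e/4"] seq.prems by auto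
  have "(LINT x|\<mu>. (u x - f x)\<^sup>2) \<le> 2 * (LINT x|\<mu>. (u x - U i x)\<^sup>2) + 2 * (LINT x|\<mu>. (U i x - f x)\<^sup>2)"
    using um seq sq f(1) by (intro L2_error_triangle continuous_in_L2[OF f(1)]) (auto simp: L2_space_def)
  also have "\<dots> < e" using i f(3) by simp
  finally show ?case using f by blast
qed

end

section \<open>Positive semidefinite Gram matrices\<close>

lemma gram_poly_conv_sum:
  fixes A :: "real mat"
  assumes "A \<in> carrier_mat (num_monomials TYPE('n::{finite,linorder}) d) (num_monomials TYPE('n) d)"
  defines "k \<equiv> num_monomials TYPE('n) d"
  shows "(gram_poly d A :: 'n rpoly) = (\<Sum>r<k. \<Sum>c<k. const_poly (A $$ (r, c)) *
      (mono_poly (monomials_upto d ! r) * mono_poly (monomials_upto d ! c)))"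
proof -
  define b where "b = (basis_vec d :: 'n rpoly Matrix.vec)"
  have b: "Matrix.vec_index b i = mono_poly (monomials_upto d ! i)" "dim_vec b = k" if "i < k" for i
    using that by (auto simp: b_def basis_vec_def length_monomials_upto k_def vec_of_list_index)
  have dim: "dim_vec b = k" "dim_row A = k" "dim_col A = k"
    using assms by (auto simp: b_def k_def)
  have "gram_poly d A = (\<Sum>r<k. Matrix.vec_index b r * (\<Sum>c<k. const_poly (A $$ (r, c)) * Matrix.vec_index b c))"
    using dim unfolding gram_poly_def b_def[symmetric]
    by (auto simp: scalar_prod_def mult_mat_vec_def lessThan_atLeast0 intro!: sum.cong)
  also have "\<dots> = (\<Sum>r<k. \<Sum>c<k. const_poly (A $$ (r, c)) *
      (mono_poly (monomials_upto d ! r) * mono_poly (monomials_upto d ! c)))"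
    unfolding sum_distrib_left by (intro sum.cong refl) (simp add: b algebra_simps)
  finally show ?thesis .
qed

lemma mat_in_psd_mats_iff:
  fixes f :: "nat \<Rightarrow> nat \<Rightarrow> real"
  shows "Matrix.mat k k (\<lambda>(r, c). f r c) \<in> psd_mats k \<longleftrightarrow>
    (\<forall>r<k. \<forall>c<k. f r c = f c r) \<and> (\<forall>v. 0 \<le> (\<Sum>r<k. \<Sum>c<k. v r * f r c * v c))"
proof -
  let ?A = "Matrix.mat k k (\<lambda>(r, c). f r c)"
  have q: "scalar_prod v (?A *\<^sub>v v) = (\<Sum>r<k. \<Sum>c<k. Matrix.vec_index v r * f r c * Matrix.vec_index v c)"
    if "v \<in> carrier_vec k" for v
    using that by (auto simp: scalar_prod_def mult_mat_vec_def lessThan_atLeast0 sum_distrib_left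
        mult.assoc intro!: sum.cong)
  have "(\<forall>v\<in>carrier_vec k. 0 \<le> scalar_prod v (?A *\<^sub>v v)) \<longleftrightarrow>
      (\<forall>v. 0 \<le> (\<Sum>r<k. \<Sum>c<k. v r * f r c * v c))"
  proof safe
    fix v assume *: "\<forall>v\<in>carrier_vec k. 0 \<le> scalar_prod v (?A *\<^sub>v v)"
    show "0 \<le> (\<Sum>r<k. \<Sum>c<k. v r * f r c * v c)"
      using bspec[OF *, of "Matrix.vec k v"] q[of "Matrix.vec k v"] by simp
  qed (simp add: q)
  moreover have "transpose_mat ?A = ?A \<longleftrightarrow> (\<forall>r<k. \<forall>c<k. f r c = f c r)"
    by (auto simp: mat_eq_iff)
  ultimately show ?thesis
    by (auto simp: psd_mats_def)
qed

text \<open>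
  A zero \<open>z\<close> of a positive semidefinite form is a minimum, so the derivative of the form at \<open>z\<close> in any
  direction vanishes.  The direction \<open>y = a z\<close> turns this into \<open>\<bar>a z\<bar>\<^sup>2 = 0\<close>.
\<close>
lemma psd_form_eq_0_imp_kernel:
  fixes a :: "nat \<Rightarrow> nat \<Rightarrow> real"
  assumes sym: "\<And>r c. a r c = a c r"
    and psd: "\<And>v. 0 \<le> (\<Sum>r<k. \<Sum>c<k. v r * a r c * v c)"
    and z: "(\<Sum>r<k. \<Sum>c<k. z r * a r c * z c) = 0"
    and r: "r < k"
  shows "(\<Sum>c<k. a r c * z c) = 0"
proof -
  define y where "y r = (\<Sum>c<k. a r c * z c)" for r
  define q where "q = (\<Sum>r<k. \<Sum>c<k. y r * a r c * y c)"
  define s where "s = (\<Sum>r<k. (y r)\<^sup>2)"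
  have q: "0 \<le> q" unfolding q_def by (rule psd)
  have s0: "0 \<le> s" unfolding s_def by (simp add: sum_nonneg)
  have yz: "(\<Sum>r<k. \<Sum>c<k. y r * a r c * z c) = s"
    by (simp add: s_def y_def power2_eq_square sum_distrib_left mult.assoc)
  have zy: "(\<Sum>r<k. \<Sum>c<k. z r * a r c * y c) = s"
    by (subst sum.swap) (simp add: yz[symmetric] sym mult.assoc mult.left_commute mult.commute)
  have line: "0 \<le> 2 * t * s + t\<^sup>2 * q" for t
  proof -
    have "(\<Sum>r<k. \<Sum>c<k. (z r + t * y r) * a r c * (z c + t * y c)) =
      (\<Sum>r<k. \<Sum>c<k. z r * a r c * z c) + t * (\<Sum>r<k. \<Sum>c<k. y r * a r c * z c)
      + t * (\<Sum>r<k. \<Sum>c<k. z r * a r c * y c) + t\<^sup>2 * q"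
      unfolding q_def sum_distrib_left sum.distrib[symmetric]
      by (intro sum.cong refl) (simp add: algebra_simps power2_eq_square)
    then show ?thesis
      using psd[of "\<lambda>r. z r + t * y r"] z yz zy by (simp add: algebra_simps)
  qed
  have "s = 0"
  proof (rule ccontr)
    assume "s \<noteq> 0"
    then have "0 < s" using s0 by simp
    \<comment> \<open>a step short enough for the linear term to outweigh the quadratic one, also if \<open>q = 0\<close>\<close>
    define t where "t = s / (q + 1)"
    have t: "0 < t" "s = t * (q + 1)"
      using \<open>0 < s\<close> q by (simp_all add: t_def)
    have "2 * (- t) * s + (- t)\<^sup>2 * q = - (t\<^sup>2 * (q + 2))"
      by (simp add: t(2) power2_eq_square algebra_simps)
    also have "\<dots> < 0"
      using t(1) q by simp
    finally show False using line[of "- t"] by simp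
  qed
  then have "(y r)\<^sup>2 = 0"
    using r by (simp add: s_def sum_nonneg_eq_0_iff)
  then show ?thesis by (simp add: y_def)
qed

text \<open>
  With the convention \<open>g\<^sub>0 = 1\<close> the summand \<open>b\<^sub>d\<^sup>T A\<^sub>0 b\<^sub>d\<close> is treated like the others, and a polynomial
  \<open>\<Sum>j\<le>m. b\<^sup>T A\<^sub>j b g\<^sub>j\<close> is a linear combination of the products \<open>x\<^sup>\<beta> x\<^sup>\<gamma> g\<^sub>j\<close> whose coefficients are the
  entries of the Gram matrices \<open>A\<^sub>j\<close>.  All entries are collected in one function \<open>w\<close>, where
  \<open>w (j, r, c)\<close> stands for the entry of \<open>A\<^sub>j\<close> in row \<open>r\<close> and column \<open>c\<close>.
\<close>
definition weight :: "(nat \<Rightarrow> 'n rpoly) \<Rightarrow> nat \<Rightarrow> 'n rpoly" where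
  "weight g j = (if j = 0 then 1 else g j)"

definition block_deg :: "(nat \<Rightarrow> 'n::finite rpoly) \<Rightarrow> nat \<Rightarrow> nat \<Rightarrow> nat" where
  "block_deg g d j = (if j = 0 then d else d - half_deg (g j))"

definition block_size :: "(nat \<Rightarrow> 'n::finite rpoly) \<Rightarrow> nat \<Rightarrow> nat \<Rightarrow> nat" where
  "block_size g d j = num_monomials TYPE('n) (block_deg g d j)"

definition block_mono :: "(nat \<Rightarrow> 'n::{finite,linorder} rpoly) \<Rightarrow> nat \<Rightarrow> nat \<Rightarrow> nat \<Rightarrow> 'n monomial" where
  "block_mono g d j = (!) (monomials_upto (block_deg g d j))"

lemma feasible_iff:
  fixes g :: "nat \<Rightarrow> 'n::{finite,linorder} rpoly"
  shows "feasible m g d (p, A) \<longleftrightarrow> poly_deg p \<le> d \<and>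
    p = (\<Sum>j\<le>m. gram_poly (block_deg g d j) (A j) * weight g j) \<and>
    (\<forall>j\<le>m. A j \<in> psd_mats (block_size g d j))"
proof -
  have "(\<Sum>j\<le>m. gram_poly (block_deg g d j) (A j) * weight g j)
     = gram_poly d (A 0) + (\<Sum>j=1..m. gram_poly (d - half_deg (g j)) (A j) * g j)"
    by (simp add: atMost_atLeast0 sum.atLeast_Suc_atMost block_deg_def weight_def)
  moreover have "(\<forall>j\<le>m. A j \<in> psd_mats (block_size g d j)) \<longleftrightarrow>
     A 0 \<in> psd_mats (num_monomials TYPE('n) d) \<and>
     (\<forall>j\<in>{1..m}. A j \<in> psd_mats (num_monomials TYPE('n) (d - half_deg (g j))))"
    by (auto simp: block_size_def block_deg_def Suc_le_eq)
  ultimately show ?thesis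
    by (simp add: feasible_def conj_assoc)
qed

definition block_index :: "(nat \<Rightarrow> 'n::finite rpoly) \<Rightarrow> nat \<Rightarrow> nat \<Rightarrow> (nat \<times> nat \<times> nat) set" where
  "block_index g m d = (SIGMA j:{..m}. {..<block_size g d j} \<times> {..<block_size g d j})"

definition block_poly :: "(nat \<Rightarrow> 'n::{finite,linorder} rpoly) \<Rightarrow> nat \<Rightarrow> nat \<times> nat \<times> nat \<Rightarrow> 'n rpoly" where
  "block_poly g d = (\<lambda>(j, r, c). mono_poly (block_mono g d j r) * mono_poly (block_mono g d j c) * weight g j)"

definition block_mat :: "(nat \<Rightarrow> 'n::finite rpoly) \<Rightarrow> nat \<Rightarrow> (nat \<times> nat \<times> nat \<Rightarrow> real) \<Rightarrow> nat \<Rightarrow> real mat" where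
  "block_mat g d w j = Matrix.mat (block_size g d j) (block_size g d j) (\<lambda>(r, c). w (j, r, c))"

definition assemble ::
  "(nat \<Rightarrow> 'n::{finite,linorder} rpoly) \<Rightarrow> nat \<Rightarrow> nat \<Rightarrow> (nat \<times> nat \<times> nat \<Rightarrow> real) \<Rightarrow> 'n rpoly" where
  "assemble g m d w = (\<Sum>i\<in>block_index g m d. const_poly (w i) * block_poly g d i)"

lemma finite_block_index [simp]: "finite (block_index g m d)"
  by (simp add: block_index_def)

lemma sum_block_index:
  "(\<Sum>i\<in>block_index g m d. F i) =
   (\<Sum>j\<le>m. \<Sum>r<block_size g d j. \<Sum>c<block_size g d j. F (j, r, c))"
  unfolding block_index_def by (simp add: sum.cartesian_product sum.Sigma split_def)

lemma assemble_conv_gram: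
  fixes g :: "nat \<Rightarrow> 'n::{finite,linorder} rpoly"
  shows "assemble g m d w = (\<Sum>j\<le>m. gram_poly (block_deg g d j) (block_mat g d w j) * weight g j)"
proof -
  have "gram_poly (block_deg g d j) (block_mat g d w j) * weight g j =
      (\<Sum>r<block_size g d j. \<Sum>c<block_size g d j. const_poly (w (j, r, c)) * block_poly g d (j, r, c))" for j
    by (subst gram_poly_conv_sum)
       (auto simp: block_mat_def block_size_def block_poly_def block_mono_def sum_distrib_right
          mult.assoc intro!: sum.cong)
  then show ?thesis
    by (simp add: assemble_def sum_block_index)
qed

lemma poly_eval_assemble:
  "poly_eval (assemble g m d w) x = (\<Sum>i\<in>block_index g m d. w i * poly_eval (block_poly g d i) x)"
  by (simp add: assemble_def)

lemma lookup_assemble: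
  "Poly_Mapping.lookup (assemble g m d w) \<alpha> =
   (\<Sum>i\<in>block_index g m d. w i * Poly_Mapping.lookup (block_poly g d i) \<alpha>)"
  by (simp add: assemble_def lookup_sum lookup_const_poly_mult)

definition gram_form ::
  "(nat \<Rightarrow> 'n::finite rpoly) \<Rightarrow> nat \<Rightarrow> (nat \<times> nat \<times> nat \<Rightarrow> real) \<Rightarrow> nat \<Rightarrow> (nat \<Rightarrow> real) \<Rightarrow> real" where
  "gram_form g d w j v = (\<Sum>r<block_size g d j. \<Sum>c<block_size g d j. v r * w (j, r, c) * v c)"

lemma poly_eval_assemble_forms:
  "poly_eval (assemble g m d w) x =
   (\<Sum>j\<le>m. gram_form g d w j (\<lambda>r. mono_eval (block_mono g d j r) x) * poly_eval (weight g j) x)"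
  unfolding poly_eval_assemble sum_block_index gram_form_def sum_distrib_right
  by (intro sum.cong refl) (simp add: block_poly_def algebra_simps)

text \<open>
  Gram families of feasible polynomials in a normal form:
  entries outside the blocks are \<open>0\<close>, and so are all entries of a block with \<open>g\<^sub>j = 0\<close>, over which
  the polynomial would otherwise have no control.  The last condition is the degree bound; the blocks on
  their own also produce polynomials of degree above \<open>d\<close>.
\<close>
definition gram_cone ::
  "(nat \<Rightarrow> 'n::{finite,linorder} rpoly) \<Rightarrow> nat \<Rightarrow> nat \<Rightarrow> (nat \<times> nat \<times> nat \<Rightarrow> real) set" where
  "gram_cone g m d = {w.
     (\<forall>j r c. (j, r, c) \<notin> block_index g m d \<or> weight g j = 0 \<longrightarrow> w (j, r, c) = 0) \<and>
     (\<forall>j r c. w (j, r, c) = w (j, c, r)) \<and>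
     (\<forall>j v. 0 \<le> gram_form g d w j v) \<and>
     (\<forall>\<alpha>. d < mono_deg \<alpha> \<longrightarrow> Poly_Mapping.lookup (assemble g m d w) \<alpha> = 0)}"

lemma closed_gram_cone: "closed (gram_cone g m d)"
proof -
  have *: "closed {w. \<forall>i. P i \<longrightarrow> Q i w}" if "\<And>i. P i \<Longrightarrow> closed {w. Q i w}"
    for P :: "'x \<Rightarrow> bool" and Q :: "'x \<Rightarrow> (nat \<times> nat \<times> nat \<Rightarrow> real) \<Rightarrow> bool"
  proof (intro closed_Collect_all)
    show "closed {w. P i \<longrightarrow> Q i w}" for i
      using that[of i] by (cases "P i") auto
  qed
  show ?thesis
    unfolding gram_cone_def gram_form_def lookup_assemble
    by (intro closed_Collect_conj closed_Collect_all * closed_Collect_eq closed_Collect_le continuous_intros; simp)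
qed

lemma gram_cone_imp_feasible:
  assumes "w \<in> gram_cone g m d"
  shows "feasible m g d (assemble g m d w, block_mat g d w)"
proof -
  have "block_mat g d w j \<in> psd_mats (block_size g d j)" for j
    unfolding block_mat_def using assms
    by (subst mat_in_psd_mats_iff[where f = "\<lambda>r c. w (j, r, c)"]) (auto simp: gram_cone_def gram_form_def)
  then show ?thesis
    using assms by (auto simp: feasible_iff assemble_conv_gram[symmetric] gram_cone_def poly_deg_le_iff)
qed

text \<open>
  Erasing the blocks with \<open>g\<^sub>j = 0\<close> does not change the polynomial.
\<close>
lemma feasible_imp_gram_cone:
  fixes g :: "nat \<Rightarrow> 'n::{finite,linorder} rpoly"
  assumes "feasible m g d (p, A)"
  shows "\<exists>w\<in>gram_cone g m d. assemble g m d w = p"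
proof -
  define w where "w = (\<lambda>(j, r, c). if (j, r, c) \<in> block_index g m d \<and> weight g j \<noteq> 0 then A j $$ (r, c) else 0)"
  have A: "A j \<in> psd_mats (block_size g d j)" if "j \<le> m" for j
    using assms that by (simp add: feasible_iff)
  have A': "A j = Matrix.mat (block_size g d j) (block_size g d j) (\<lambda>(r, c). A j $$ (r, c))" if "j \<le> m" for j
    using A[OF that] by (auto simp: psd_mats_def)
  have idx: "(j, r, c) \<in> block_index g m d \<longleftrightarrow> j \<le> m \<and> r < block_size g d j \<and> c < block_size g d j" for j r c
    by (simp add: block_index_def)
  have w_eq: "w (j, r, c) = A j $$ (r, c)"
    if "j \<le> m" "weight g j \<noteq> 0" "r < block_size g d j" "c < block_size g d j" for j r c
    using that by (simp add: w_def idx)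
  have w_0: "w (j, r, c) = 0" if "\<not> (j \<le> m \<and> weight g j \<noteq> 0)" for j r c
    using that by (auto simp: w_def idx)
  have psd: "(\<forall>r<block_size g d j. \<forall>c<block_size g d j. A j $$ (r, c) = A j $$ (c, r))"
    "0 \<le> (\<Sum>r<block_size g d j. \<Sum>c<block_size g d j. v r * A j $$ (r, c) * v c)" if "j \<le> m" for j v
    using A[OF that] mat_in_psd_mats_iff[of "block_size g d j" "\<lambda>r c. A j $$ (r, c)"] A'[OF that] by auto
  have eq: "assemble g m d w = p"
  proof -
    have "gram_poly (block_deg g d j) (block_mat g d w j) * weight g j
        = gram_poly (block_deg g d j) (A j) * weight g j" if "j \<le> m" for j
    proof (cases "weight g j = 0")
      case False
      then have "block_mat g d w j = A j"
        using A'[OF that] w_eq[OF that False] by (auto simp: block_mat_def mat_eq_iff)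
      then show ?thesis by simp
    qed simp
    then have "assemble g m d w = (\<Sum>j\<le>m. gram_poly (block_deg g d j) (A j) * weight g j)"
      unfolding assemble_conv_gram by (intro sum.cong) auto
    then show ?thesis
      using assms by (simp add: feasible_iff)
  qed
  have "w \<in> gram_cone g m d"
    unfolding gram_cone_def
  proof (intro CollectI conjI allI impI)
    show "w (j, r, c) = 0" if "(j, r, c) \<notin> block_index g m d \<or> weight g j = 0" for j r c
      using that by (auto simp: w_def)
    show "w (j, r, c) = w (j, c, r)" for j r c
      using psd(1)[of j] by (auto simp: w_def idx)
    show "0 \<le> gram_form g d w j v" for j v
    proof (cases "j \<le> m \<and> weight g j \<noteq> 0")
      case True
      then have "gram_form g d w j v = (\<Sum>r<block_size g d j. \<Sum>c<block_size g d j. v r * A j $$ (r, c) * v c)"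
        unfolding gram_form_def by (intro sum.cong refl) (simp add: w_eq)
      then show ?thesis using psd(2) True by simp
    next
      case False
      then show ?thesis by (simp add: gram_form_def w_0)
    qed
    show "Poly_Mapping.lookup (assemble g m d w) \<alpha> = 0" if "d < mono_deg \<alpha>" for \<alpha>
    proof -
      have "poly_deg p \<le> d" using assms unfolding feasible_iff by blast
      then show ?thesis using that unfolding eq poly_deg_le_iff by blast
    qed
  qed
  with eq show ?thesis by blast
qed

lemma gram_cone_0: "(\<lambda>_. 0) \<in> gram_cone g m d"
  by (simp add: gram_cone_def gram_form_def lookup_assemble)

lemma gram_cone_scale:
  assumes "w \<in> gram_cone g m d" "0 \<le> t"
  shows "(\<lambda>i. t * w i) \<in> gram_cone g m d"
proof -
  have "gram_form g d (\<lambda>i. t * w i) j v = t * gram_form g d w j v" for j v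
    unfolding gram_form_def sum_distrib_left by (intro sum.cong refl) (simp add: algebra_simps)
  moreover have "Poly_Mapping.lookup (assemble g m d (\<lambda>i. t * w i)) \<alpha> =
      t * Poly_Mapping.lookup (assemble g m d w) \<alpha>" for \<alpha>
    unfolding lookup_assemble sum_distrib_left by (intro sum.cong refl) (simp add: algebra_simps)
  ultimately show ?thesis
    using assms unfolding gram_cone_def by auto
qed

text \<open>
  The Gram matrix is \<open>A\<^sub>0 = c c\<^sup>T\<close> for the coefficient vector \<open>c\<close> of \<open>h\<close>; all other blocks vanish.
  Hence one and the same square is feasible for all large \<open>d\<close>.
\<close>
lemma square_feasible:
  fixes g :: "nat \<Rightarrow> 'n::{finite,linorder} rpoly" and h :: "'n rpoly"
  assumes "poly_deg h \<le> d" "poly_deg (h * h) \<le> d"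
  shows "\<exists>A. feasible m g d (h * h, A)"
proof -
  define k where "k = num_monomials TYPE('n) d"
  define b :: "nat \<Rightarrow> 'n monomial" where "b r = monomials_upto d ! r" for r
  define c where "c r = Poly_Mapping.lookup h (b r)" for r
  define A where "A j = (if j = 0 then Matrix.mat k k (\<lambda>(r, s). c r * c s)
      else Matrix.mat (block_size g d j) (block_size g d j) (\<lambda>(r, s). 0))" for j :: nat
  have bij: "bij_betw b {..<k} {\<alpha>. mono_deg \<alpha> \<le> d}"
    unfolding b_def k_def set_monomials_upto[symmetric]
    by (rule bij_betw_nth) (simp_all add: distinct_monomials_upto length_monomials_upto)
  have fin: "finite {\<alpha> :: 'n monomial. mono_deg \<alpha> \<le> d}"
    unfolding set_monomials_upto[symmetric] by simp
  have h: "(\<Sum>r<k. Poly_Mapping.single (b r) (c r)) = h"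
  proof -
    have "(\<Sum>r<k. Poly_Mapping.single (b r) (c r)) =
        (\<Sum>\<alpha>\<in>{\<alpha>. mono_deg \<alpha> \<le> d}. Poly_Mapping.single \<alpha> (Poly_Mapping.lookup h \<alpha>))"
      unfolding c_def by (rule sum.reindex_bij_betw[OF bij])
    also have "\<dots> = (\<Sum>\<alpha>\<in>Poly_Mapping.keys h. Poly_Mapping.single \<alpha> (Poly_Mapping.lookup h \<alpha>))"
      using assms(1) fin by (intro sum.mono_neutral_right)
        (auto simp: poly_deg_le_iff in_keys_iff not_le[symmetric])
    finally show ?thesis by (simp add: poly_mapping_sum_single)
  qed
  have psd: "A j \<in> psd_mats (block_size g d j)" for j
  proof (cases "j = 0")
    case True
    have "(\<Sum>r<k. \<Sum>s<k. v r * (c r * c s) * v s) = (\<Sum>r<k. v r * c r)\<^sup>2" for v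
      by (simp add: power2_eq_square sum_product mult.assoc mult.left_commute mult.commute)
    moreover have "block_size g d 0 = k"
      by (simp add: block_size_def block_deg_def k_def)
    ultimately show ?thesis
      using True mat_in_psd_mats_iff[of k "\<lambda>r s. c r * c s"] by (simp add: A_def)
  next
    case False
    then show ?thesis
      using mat_in_psd_mats_iff[of "block_size g d j" "\<lambda>r s. 0"] by (simp add: A_def)
  qed
  have "gram_poly (block_deg g d j) (A j) * weight g j = (if j = 0 then h * h else 0)" for j
  proof (cases "j = 0")
    case True
    have "gram_poly d (A 0) = (\<Sum>r<k. \<Sum>s<k. Poly_Mapping.single (b r) (c r) * Poly_Mapping.single (b s) (c s))"
      by (subst gram_poly_conv_sum)
         (auto simp: A_def k_def b_def const_poly_def mono_poly_def mult_single intro!: sum.cong)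
    also have "\<dots> = h * h"
      by (subst (1 2) h[symmetric]) (simp add: sum_product)
    finally show ?thesis using True by (simp add: block_deg_def weight_def)
  next
    case False
    then have "(gram_poly (block_deg g d j) (A j) :: 'n rpoly) = 0"
      by (subst gram_poly_conv_sum) (auto simp: A_def block_size_def const_poly_def)
    then show ?thesis using False by simp
  qed
  then have "(\<Sum>j\<le>m. gram_poly (block_deg g d j) (A j) * weight g j) = h * h"
    by (simp add: sum.delta)
  then have "feasible m g d (h * h, A)"
    using psd assms(2) by (simp add: feasible_iff)
  then show ?thesis by blast
qed

section \<open>Existence and convergence of minimisers\<close>

lemma continuous_AE_eq_0_imp_eq_0_on_support:
  fixes f :: "'a::topological_space \<Rightarrow> real"
  assumes "continuous_on UNIV f" "f \<in> borel_measurable \<mu>" "AE x in \<mu>. f x = 0" "x \<in> measure_support \<mu>"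
  shows "f x = 0"
proof (rule ccontr)
  assume "f x \<noteq> 0"
  define U where "U = {y. f y \<noteq> 0}"
  have "open U"
    unfolding U_def by (intro open_Collect_neq assms continuous_on_const)
  then have "0 < emeasure \<mu> (U \<inter> space \<mu>)"
    using assms(4) \<open>f x \<noteq> 0\<close> by (auto simp: measure_support_def U_def)
  moreover have "U \<inter> space \<mu> = {y \<in> space \<mu>. \<not> f y = 0}"
    by (auto simp: U_def)
  ultimately show False
    using assms(2,3) by (simp add: AE_iff_measurable[OF _ refl])
qed

lemma objective_conv_integral: "objective \<mu> u p = (LINT x|\<mu>. (u x - poly_eval p x)\<^sup>2)"
  by (simp add: objective_def L2_norm_def)

locale sos_approximation = compactly_supported_finite_measure \<mu> \<Omega>
  for \<mu> :: "(real ^ 'n::{finite,linorder}) measure" and \<Omega> +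
  fixes g :: "nat \<Rightarrow> 'n::{finite,linorder} rpoly" and m :: nat
    and u :: "real ^ 'n::{finite,linorder} \<Rightarrow> real"
  assumes Omega_eq: "\<Omega> = semialg_set m g"
    and interior_Omega: "interior \<Omega> \<noteq> {}"
    and support_mu: "measure_support \<mu> = \<Omega>"
    and u_L2: "u \<in> L2_space \<mu>"
begin

lemma poly_eval_L2: "poly_eval p \<in> L2_space \<mu>"
  by (intro continuous_in_L2 continuous_on_poly_eval)

lemma poly_eval_integrable: "integrable \<mu> (poly_eval p)"
proof -
  have "(\<lambda>_. 1) \<in> L2_space \<mu>" by (intro continuous_in_L2 continuous_on_const)
  from integrable_L2_mult[OF this poly_eval_L2[of p]] show ?thesis by simp
qed

lemma weight_nonneg: "x \<in> \<Omega> \<Longrightarrow> j \<le> m \<Longrightarrow> 0 \<le> poly_eval (weight g j) x"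
  by (auto simp: Omega_eq semialg_set_def weight_def)

lemma assemble_nonneg:
  assumes "w \<in> gram_cone g m d" "x \<in> \<Omega>"
  shows "0 \<le> poly_eval (assemble g m d w) x"
  unfolding poly_eval_assemble_forms using assms weight_nonneg
  by (intro sum_nonneg mult_nonneg_nonneg) (auto simp: gram_cone_def)

text \<open>
  All summands \<open>b\<^sup>T A\<^sub>j b g\<^sub>j\<close> are nonnegative on \<open>\<Omega>\<close>, so they vanish there individually.  If
  \<open>g\<^sub>j \<noteq> 0\<close>, then \<open>g\<^sub>j\<close> has no zero on some open subset \<open>V\<close> of \<open>\<Omega>\<close>, where consequently \<open>A\<^sub>j b(x) = 0\<close>; each
  row of \<open>A\<^sub>j\<close> is then a linear relation between distinct monomials on \<open>V\<close>.
\<close>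
lemma assemble_vanishing_imp_0:
  assumes w: "w \<in> gram_cone g m d" and 0: "\<And>x. x \<in> \<Omega> \<Longrightarrow> poly_eval (assemble g m d w) x = 0"
  shows "w = (\<lambda>_. 0)"
proof -
  have "w (j, r, c) = 0" for j r c
  proof (cases "(j, r, c) \<in> block_index g m d \<and> weight g j \<noteq> 0")
    case False
    then show ?thesis using w unfolding gram_cone_def by blast
  next
    case True
    then have j: "j \<le> m" "weight g j \<noteq> 0" and rc: "r < block_size g d j" "c < block_size g d j"
      by (auto simp: block_index_def)
    define V where "V = interior \<Omega> \<inter> {x. poly_eval (weight g j) x \<noteq> 0}"
    have "open V"
      unfolding V_def
      by (intro open_Int open_interior open_Collect_neq continuous_on_poly_eval continuous_on_const)
    have "V \<noteq> {}"
      using poly_eq_0_if_eval_eq_0_on_open[OF open_interior interior_Omega] j(2)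
      by (auto simp: V_def)
    let ?b = "\<lambda>x r. mono_eval (block_mono g d j r) x"
    have "(\<Sum>c<block_size g d j. w (j, r, c) * ?b x c) = 0" if x: "x \<in> V" for x
    proof (rule psd_form_eq_0_imp_kernel[OF _ _ _ rc(1)])
      show "w (j, r, c) = w (j, c, r)" for r c
        using w unfolding gram_cone_def by blast
      show "0 \<le> (\<Sum>r<block_size g d j. \<Sum>c<block_size g d j. v r * w (j, r, c) * v c)" for v
        using w by (auto simp: gram_cone_def gram_form_def)
      have xO: "x \<in> \<Omega>" using x interior_subset by (auto simp: V_def)
      have "gram_form g d w j (?b x) * poly_eval (weight g j) x = 0"
      proof -
        have "\<forall>j\<in>{..m}. gram_form g d w j (\<lambda>r. mono_eval (block_mono g d j r) x) * poly_eval (weight g j) x = 0"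
        proof (subst sum_nonneg_eq_0_iff[symmetric])
          show "0 \<le> gram_form g d w j (\<lambda>r. mono_eval (block_mono g d j r) x) * poly_eval (weight g j) x"
            if "j \<in> {..m}" for j
            using that w weight_nonneg[OF xO] by (auto simp: gram_cone_def)
        qed (use 0[OF xO] in \<open>auto simp: poly_eval_assemble_forms\<close>)
        then show ?thesis using j(1) by blast
      qed
      then show "(\<Sum>r<block_size g d j. \<Sum>c<block_size g d j. ?b x r * w (j, r, c) * ?b x c) = 0"
        using x by (simp add: V_def gram_form_def)
    qed
    then show "w (j, r, c) = 0"
    proof (intro mono_eval_linear_independent[OF \<open>open V\<close> \<open>V \<noteq> {}\<close>, of "{..<block_size g d j}"
          "block_mono g d j" "\<lambda>c. w (j, r, c)" c])
      show "inj_on (block_mono g d j) {..<block_size g d j}"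
        unfolding block_mono_def
        by (rule inj_on_nth[OF distinct_monomials_upto]) (simp add: block_size_def length_monomials_upto)
    qed (use rc in auto)
  qed
  then show ?thesis by auto
qed

lemma integral_assemble_pos:
  assumes w: "w \<in> gram_cone g m d" "w \<noteq> (\<lambda>_. 0)"
  shows "0 < (LINT x|\<mu>. poly_eval (assemble g m d w) x)"
proof (rule ccontr)
  let ?p = "poly_eval (assemble g m d w)"
  have nn: "AE x in \<mu>. 0 \<le> ?p x"
    using assemble_nonneg[OF w(1)] by (auto simp: space_mu)
  assume "\<not> 0 < (LINT x|\<mu>. ?p x)"
  then have "(LINT x|\<mu>. ?p x) = 0"
    using integral_nonneg_AE[OF nn] by simp
  then have "AE x in \<mu>. ?p x = 0"
    using integral_nonneg_eq_0_iff_AE[OF poly_eval_integrable nn] by simp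
  then have "?p x = 0" if "x \<in> \<Omega>" for x
    using that support_mu poly_eval_L2[of "assemble g m d w"]
    by (intro continuous_AE_eq_0_imp_eq_0_on_support[of _ \<mu>] continuous_on_poly_eval)
       (auto simp: L2_space_def)
  then show False
    using assemble_vanishing_imp_0[OF w(1)] w(2) by blast
qed

text \<open>
  The functional \<open>p \<mapsto> \<integral>p d\<mu>\<close> is linear in the Gram entries and positive on the nonzero elements of the
  cone, and it is bounded in terms of the objective value.  So the minimum over the cone is attained.
\<close>
lemma ex_optimal_solution: "\<exists>p A. optimal_solution \<mu> u m g d (p, A)"
proof -
  let ?I = "block_index g m d"
  define Q where "Q w = objective \<mu> u (assemble g m d w)" for w
  have Q_eq: "Q w = (LINT x|\<mu>. (u x - (\<Sum>i\<in>?I. w i * poly_eval (block_poly g d i) x))\<^sup>2)" for w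
    by (simp add: Q_def objective_conv_integral poly_eval_assemble)
  define l where "l i = (LINT x|\<mu>. poly_eval (block_poly g d i) x)" for i
  have l: "(\<Sum>i\<in>?I. l i * w i) = (LINT x|\<mu>. poly_eval (assemble g m d w) x)" for w
    using poly_eval_integrable
    by (simp add: l_def poly_eval_assemble mult.commute)
  have "\<exists>w\<in>gram_cone g m d. \<forall>w'\<in>gram_cone g m d. Q w \<le> Q w'"
  proof (rule attains_min_on_closed_cone[where I = ?I and l = l])
    show "continuous_on UNIV Q"
      unfolding Q_eq by (rule continuous_on_L2_error) (use u_L2 poly_eval_L2 in auto)
    show "w i = 0" if "w \<in> gram_cone g m d" "i \<notin> ?I" for w i
      using that by (cases i) (auto simp: gram_cone_def)
    show "0 < (\<Sum>i\<in>?I. l i * w i)" if "w \<in> gram_cone g m d" "w \<noteq> (\<lambda>_. 0)" for w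
      unfolding l by (rule integral_assemble_pos[OF that])
    fix w assume w: "w \<in> gram_cone g m d" and le: "Q w \<le> Q (\<lambda>_. 0)"
    let ?p = "poly_eval (assemble g m d w)"
    have i: "integrable \<mu> (\<lambda>x. (u x)\<^sup>2)" "integrable \<mu> (\<lambda>x. (u x - ?p x)\<^sup>2)"
      using u_L2 L2_space_diff[OF u_L2 poly_eval_L2] by (auto simp: L2_space_def)
    have "?p x \<le> 1 + 2 * (u x - ?p x)\<^sup>2 + 2 * (u x)\<^sup>2" for x
    proof -
      \<comment> \<open>use \<open>p \<le> 1 + p\<^sup>2\<close> and \<open>p\<^sup>2 \<le> 2 (u - p)\<^sup>2 + 2 u\<^sup>2\<close>\<close>
      have "0 \<le> (2 * u x - ?p x)\<^sup>2" "0 \<le> (?p x - 1/2)\<^sup>2" by simp_all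
      then show ?thesis by (simp add: power2_eq_square algebra_simps)
    qed
    then have "(LINT x|\<mu>. ?p x) \<le> (LINT x|\<mu>. 1 + 2 * (u x - ?p x)\<^sup>2 + 2 * (u x)\<^sup>2)"
      using i poly_eval_integrable by (intro integral_mono) auto
    also have "\<dots> = measure \<mu> \<Omega> + 2 * Q w + 2 * (LINT x|\<mu>. (u x)\<^sup>2)"
      using i by (simp add: Q_def objective_conv_integral space_mu)
    also have "\<dots> \<le> measure \<mu> \<Omega> + 2 * Q (\<lambda>_. 0) + 2 * (LINT x|\<mu>. (u x)\<^sup>2)"
      using le by simp
    finally show "(\<Sum>i\<in>?I. l i * w i) \<le> measure \<mu> \<Omega> + 2 * Q (\<lambda>_. 0) + 2 * (LINT x|\<mu>. (u x)\<^sup>2)"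
      unfolding l .
  qed (simp_all add: closed_gram_cone gram_cone_0 gram_cone_scale)
  then obtain w where w: "w \<in> gram_cone g m d" "\<And>w'. w' \<in> gram_cone g m d \<Longrightarrow> Q w \<le> Q w'"
    by blast
  have "optimal_solution \<mu> u m g d (assemble g m d w, block_mat g d w)"
    unfolding optimal_solution_def is_arg_min_def
  proof (intro conjI notI)
    show "feasible m g d (assemble g m d w, block_mat g d w)"
      by (rule gram_cone_imp_feasible[OF w(1)])
    assume "\<exists>y. feasible m g d y \<and> (case y of (p, A) \<Rightarrow> objective \<mu> u p)
        < (case (assemble g m d w, block_mat g d w) of (p, A) \<Rightarrow> objective \<mu> u p)"
    then obtain p A where pA: "feasible m g d (p, A)" "objective \<mu> u p < Q w"
      by (auto simp: Q_def)
    from feasible_imp_gram_cone[OF pA(1)] obtain w' where "w' \<in> gram_cone g m d" "assemble g m d w' = p"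
      by blast
    then show False
      using w(2)[of w'] pA(2) by (simp add: Q_def)
  qed
  then show ?thesis by blast
qed

text \<open>
  Approximate \<open>u\<close> in \<open>L\<^sup>2\<close> by a continuous \<open>f \<ge> 0\<close>, and \<open>sqrt f\<close> uniformly on \<open>\<Omega>\<close> by a polynomial \<open>h\<close>.
  Then \<open>h\<^sup>2\<close> is uniformly close to \<open>f\<close>, because
  \<open>f - h\<^sup>2 = (sqrt f - h) (sqrt f + h)\<close> and the second factor is bounded.
\<close>
lemma square_approx:
  assumes u0: "AE x in \<mu>. 0 \<le> u x" and e: "0 < e"
  shows "\<exists>h :: 'n rpoly. objective \<mu> u (h * h) < e"
proof -
  \<comment> \<open>a version of \<open>u\<close> that is nonnegative everywhere and not just almost everywhere\<close>
  define u' where "u' x = max 0 (u x)" for x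
  have u': "u' \<in> borel_measurable \<mu>"
    unfolding u'_def[abs_def] using u_L2 by (auto simp: L2_space_def)
  have ae: "AE x in \<mu>. u' x = u x"
    using u0 by eventually_elim (auto simp: u'_def)
  have "integrable \<mu> (\<lambda>x. (u' x)\<^sup>2) \<longleftrightarrow> integrable \<mu> (\<lambda>x. (u x)\<^sup>2)"
    using u' u_L2 ae by (intro integrable_cong_AE) (auto simp: L2_space_def)
  then have u'2: "integrable \<mu> (\<lambda>x. (u' x)\<^sup>2)"
    using u_L2 by (simp add: L2_space_def)
  then have u'L2: "u' \<in> L2_space \<mu>"
    using u' by (simp add: L2_space_def)
  obtain f where f: "continuous_on UNIV f" "\<And>x. 0 \<le> f x" "(LINT x|\<mu>. (u' x - f x)\<^sup>2) < e / 4"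
    using nonneg_L2_approx[OF u' _ u'2, of "e/4"] e by (auto simp: u'_def)
  have s: "continuous_on \<Omega> (\<lambda>x. sqrt (f x))"
    using continuous_on_subset[OF f(1)] by (intro continuous_intros) auto
  obtain B where B: "0 < B" "\<And>x. x \<in> \<Omega> \<Longrightarrow> sqrt (f x) \<le> B"
  proof -
    have "bounded ((\<lambda>x. sqrt (f x)) ` \<Omega>)"
      by (intro compact_imp_bounded compact_continuous_image s compact_Omega)
    then obtain B where "\<And>x. x \<in> \<Omega> \<Longrightarrow> norm (sqrt (f x)) \<le> B"
      unfolding bounded_iff by blast
    then show ?thesis
      using that[of "max 1 B"] f(2) by fastforce
  qed
  define M where "M = measure \<mu> \<Omega>"
  have M: "0 \<le> M" by (simp add: M_def)
  \<comment> \<open>\<open>2 * B + 1\<close> bounds \<open>sqrt f + h\<close> as soon as \<open>\<delta> \<le> 1\<close>; the pointwise error \<open>\<delta> * (2 * B + 1)\<close> is to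
    have square at most \<open>e / (4 * (M + 1))\<close>, whose integral is below \<open>e / 4\<close> even if \<open>M = 0\<close>\<close>
  define \<delta> where "\<delta> = min 1 (sqrt (e / (4 * (M + 1))) / (2 * B + 1))"
  have \<delta>: "0 < \<delta>" "\<delta> \<le> 1" "\<delta> * (2 * B + 1) \<le> sqrt (e / (4 * (M + 1)))"
  proof -
    show "0 < \<delta>" "\<delta> \<le> 1" using e M B by (auto simp: \<delta>_def)
    have "\<delta> \<le> sqrt (e / (4 * (M + 1))) / (2 * B + 1)" by (simp add: \<delta>_def)
    then show "\<delta> * (2 * B + 1) \<le> sqrt (e / (4 * (M + 1)))"
      using B(1) by (simp add: pos_le_divide_eq)
  qed
  obtain q where q: "real_polynomial_function q" "\<And>x. x \<in> \<Omega> \<Longrightarrow> \<bar>sqrt (f x) - q x\<bar> < \<delta>"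
    using Stone_Weierstrass_real_polynomial_function[OF compact_Omega s \<delta>(1)] by metis
  obtain h where h: "q = poly_eval h"
    using real_polynomial_function_imp_poly_eval[OF q(1)] by blast
  have close: "(f x - poly_eval (h * h) x)\<^sup>2 \<le> e / (4 * (M + 1))" if "x \<in> \<Omega>" for x
  proof -
    have "\<bar>sqrt (f x) + q x\<bar> \<le> 2 * B + 1"
      using q(2)[OF that] B(2)[OF that] real_sqrt_ge_zero[OF f(2)[of x]] \<delta>(2) by linarith
    then have "\<bar>sqrt (f x) - q x\<bar> * \<bar>sqrt (f x) + q x\<bar> \<le> \<delta> * (2 * B + 1)"
      using q(2)[OF that] \<delta>(1) by (intro mult_mono) auto
    also have "\<bar>sqrt (f x) - q x\<bar> * \<bar>sqrt (f x) + q x\<bar> = \<bar>f x - poly_eval (h * h) x\<bar>"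
    proof -
      have "(sqrt (f x) - q x) * (sqrt (f x) + q x) = sqrt (f x) * sqrt (f x) - q x * q x"
        by (simp add: algebra_simps)
      also have "\<dots> = f x - poly_eval (h * h) x"
        using f(2)[of x] by (simp add: h)
      finally show ?thesis by (simp add: abs_mult[symmetric])
    qed
    finally have "\<bar>f x - poly_eval (h * h) x\<bar> \<le> sqrt (e / (4 * (M + 1)))"
      using \<delta>(3) by simp
    then have "\<bar>f x - poly_eval (h * h) x\<bar>\<^sup>2 \<le> (sqrt (e / (4 * (M + 1))))\<^sup>2"
      by (intro power_mono) auto
    then show ?thesis using e M by simp
  qed
  have hL2: "poly_eval (h * h) \<in> L2_space \<mu>" and fL2: "f \<in> L2_space \<mu>"
    using poly_eval_L2 continuous_in_L2[OF f(1)] by blast+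
  have "(LINT x|\<mu>. (f x - poly_eval (h * h) x)\<^sup>2) \<le> (LINT x|\<mu>. e / (4 * (M + 1)))"
    using L2_space_diff[OF fL2 hL2] close
    by (intro integral_mono) (auto simp: L2_space_def space_mu)
  also have "\<dots> = M * (e / (4 * (M + 1)))"
    by (simp add: space_mu M_def)
  also have "\<dots> < e / 4"
    using e M by (simp add: field_simps)
  finally have fh: "(LINT x|\<mu>. (f x - poly_eval (h * h) x)\<^sup>2) < e / 4" .
  have "objective \<mu> u (h * h) = (LINT x|\<mu>. (u' x - poly_eval (h * h) x)\<^sup>2)"
    unfolding objective_conv_integral using ae L2_space_diff[OF u_L2 hL2] L2_space_diff[OF u'L2 hL2]
    by (intro integral_cong_AE) (auto simp: L2_space_def)
  also have "\<dots> \<le> 2 * (LINT x|\<mu>. (u' x - f x)\<^sup>2) + 2 * (LINT x|\<mu>. (f x - poly_eval (h * h) x)\<^sup>2)"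
    by (rule L2_error_triangle[OF u'L2 fL2 hL2])
  also have "\<dots> < e" using f(3) fh by simp
  finally show ?thesis by blast
qed

lemma optimal_error_tendsto_0:
  assumes u0: "AE x in \<mu>. 0 \<le> u x"
    and opt: "\<And>d. d0 \<le> d \<Longrightarrow> optimal_solution \<mu> u m g d (p d, A d)"
  shows "(\<lambda>d. objective \<mu> u (p d)) \<longlonglongrightarrow> 0"
proof (rule LIMSEQ_I)
  fix e :: real assume "0 < e"
  then obtain h :: "'n rpoly" where h: "objective \<mu> u (h * h) < e"
    using square_approx[OF u0] by blast
  have "norm (objective \<mu> u (p d) - 0) < e" if d: "max d0 (max (poly_deg h) (poly_deg (h * h))) \<le> d" for d
  proof -
    obtain A' where "feasible m g d (h * h, A')"
      using square_feasible[of h d] d by auto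
    then have "objective \<mu> u (p d) \<le> objective \<mu> u (h * h)"
      using opt[of d] d by (force simp: optimal_solution_def is_arg_min_def not_less)
    moreover have "0 \<le> objective \<mu> u (p d)"
      by (simp add: objective_def)
    ultimately show ?thesis using h by simp
  qed
  then show "\<exists>no. \<forall>n\<ge>no. norm (objective \<mu> u (p n) - 0) < e" by blast
qed

end

theorem proposition4:
  fixes g :: "nat \<Rightarrow> 'n::{finite,linorder} rpoly"
    and m :: nat
    and \<Omega> :: "(real ^ 'n::{finite,linorder}) set"
    and \<mu> :: "(real ^ 'n::{finite,linorder}) measure"
    and u :: "real ^ 'n::{finite,linorder} \<Rightarrow> real"
    and d0 :: nat
  assumes Omega: "\<Omega> = semialg_set m g" "compact \<Omega>" "interior \<Omega> \<noteq> {}"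
    and d0: "d0 = (MAX j\<in>{1..m}. half_deg (g j))"
    and mu: "sets \<mu> = sets (restrict_space borel \<Omega>)" "finite_measure \<mu>" "measure_support \<mu> = \<Omega>"
    and u: "u \<in> L2_space \<mu>" "AE x in \<mu>. 0 \<le> u x"
  shows "(\<forall>d\<ge>d0. \<exists>p A. optimal_solution \<mu> u m g d (p, A)) \<and>
    (\<forall>p A. (\<forall>d\<ge>d0. optimal_solution \<mu> u m g d (p d, A d)) \<longrightarrow>
       (\<lambda>d. (L2_norm \<mu> (\<lambda>x. u x - poly_eval (p d) x))\<^sup>2) \<longlonglongrightarrow> 0)"
proof -
  interpret finite_measure \<mu> by (rule mu(2))
  interpret sos_approximation \<mu> \<Omega> g m u
    by unfold_locales (rule Omega mu u)+
  show ?thesis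
    using ex_optimal_solution optimal_error_tendsto_0[OF u(2)]
    unfolding objective_def by blast
qed

end
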